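(* Let $\mathscr O_2$ be a finite local principal ideal ring of length two whose residue field $k$ has characteristic $p$, an odd prime. Let $L>0$ be an integer coprime to $p$. Let $A\in \mathrm{GL}_n(\mathscr O_2)$ be regular semisimple, with characteristic polynomial $\chi_{\mathscr O_2,A}(t)=\det(tI-A)\in\mathscr O_2[t]$. Then there exists $B\in\mathrm{GL}_n(\mathscr O_2)$ with $B^L=A$ if and only if each (monic) fundamental irreducible factor of $\chi_{\mathscr O_2,A}(t)$ is an $L$-power polynomial.
   Context: Let $\mathfrak m$ be the maximal ideal of $\mathscr O_2$ (length two means $\mathfrak m\neq 0$, $\mathfrak m^2=0$) and $k=\mathscr O_2/\mathfrak m$. An overline denotes reduction modulo $\mathfrak m$ of ring elements, polynomials and matrices. A matrix $A\in\mathrm{GL}_n(\mathscr O_2)$ is regular semisimple if $\overline A\in\mathrm{GL}_n(k)$ is regular semisimple, i.e. the characteristic polynomial of $\overline A$ is separable. A polynomial $F\in\mathscr O_2[t]$ is fundamental irreducible if $\overline F$ is irreducible in $k[t]$. For $A$ regular semisimple, $\chi_{\mathscr O_2,A}(t)$ factors uniquely, up to order, as a product of pairwise coprime monic fundamental irreducible polynomials; these are its fundamental irreducible factors. A monic fundamental irreducible polynomial $F(t)\in\mathscr O_2[t]$ of degree $d$ is an $L$-power polynomial if $F(t^L)$ has a monic fundamental irreducible factor $G(t)\in\mathscr O_2[t]$ of degree $d$. *)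

theory Defs
  imports "Jordan_Normal_Form.Char_Poly"
begin

context comm_ring_1
begin

definition ring_ideal :: "'a set \<Rightarrow> bool" where
  "ring_ideal I \<longleftrightarrow>
     0 \<in> I \<and> (\<forall>x\<in>I. \<forall>y\<in>I. x + y \<in> I) \<and> (\<forall>r. \<forall>x\<in>I. r * x \<in> I)"

definition maximal_ring_ideal :: "'a set \<Rightarrow> bool" where
  "maximal_ring_ideal M \<longleftrightarrow>
     ring_ideal M \<and> M \<noteq> UNIV \<and> (\<forall>J. ring_ideal J \<and> M \<subseteq> J \<longrightarrow> J = M \<or> J = UNIV)"

end

text \<open>For the maximal ideal \<open>\<mm>\<close>, length two
  means \<open>\<mm> \<noteq> 0\<close> and \<open>\<mm>\<^sup>2 = 0\<close>; the latter says that all products of two elements of \<open>\<mm>\<close> vanish.\<close>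

class finite_local_pir2 = comm_ring_1 + finite +
  assumes principal_ideals: "ring_ideal I \<Longrightarrow> \<exists>a. I = range (\<lambda>x. a * x)"
    and local_ring: "\<exists>!M. maximal_ring_ideal M"
    and maximal_ideal_nonzero: "maximal_ring_ideal M \<Longrightarrow> M \<noteq> {0}"
    and maximal_ideal_square_zero:
      "maximal_ring_ideal M \<Longrightarrow> x \<in> M \<Longrightarrow> y \<in> M \<Longrightarrow> x * y = 0"
begin

definition max_ideal :: "'a set" where
  "max_ideal = (THE M. maximal_ring_ideal M)"

lemma max_ideal: "maximal_ring_ideal max_ideal"
  unfolding max_ideal_def by (rule theI') (rule local_ring)

lemma ring_ideal_max_ideal: "ring_ideal max_ideal"
  using max_ideal by (simp add: maximal_ring_ideal_def)

lemma max_ideal_zero [simp]: "0 \<in> max_ideal"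
  using ring_ideal_max_ideal by (simp add: ring_ideal_def)

lemma max_ideal_add: "x \<in> max_ideal \<Longrightarrow> y \<in> max_ideal \<Longrightarrow> x + y \<in> max_ideal"
  using ring_ideal_max_ideal by (simp add: ring_ideal_def)

lemma max_ideal_mult: "x \<in> max_ideal \<Longrightarrow> r * x \<in> max_ideal"
  using ring_ideal_max_ideal by (simp add: ring_ideal_def)

lemma max_ideal_uminus: "x \<in> max_ideal \<Longrightarrow> - x \<in> max_ideal"
  using max_ideal_mult[of x "- 1"] by simp

lemma max_ideal_diff: "x \<in> max_ideal \<Longrightarrow> y \<in> max_ideal \<Longrightarrow> x - y \<in> max_ideal"
  using max_ideal_add[OF _ max_ideal_uminus] by fastforce

lemma one_notin_max_ideal: "1 \<notin> max_ideal"
proof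
  assume "1 \<in> max_ideal"
  then have "r \<in> max_ideal" for r
    using max_ideal_mult[of 1 r] by simp
  then show False
    using max_ideal by (auto simp: maximal_ring_ideal_def)
qed

lemma inverse_mod_max_ideal:
  assumes "x \<notin> max_ideal"
  shows "\<exists>y. y * x - 1 \<in> max_ideal"
proof -
  define J where "J = {z. \<exists>m\<in>max_ideal. \<exists>r. z = m + r * x}"
  have "ring_ideal J"
    unfolding ring_ideal_def
  proof (intro conjI ballI allI)
    have "0 = 0 + 0 * x" by simp
    then show "0 \<in> J"
      unfolding J_def using max_ideal_zero by blast
  next
    fix a b assume "a \<in> J" "b \<in> J"
    then obtain m r m' r' where *: "m \<in> max_ideal" "m' \<in> max_ideal"
      and "a = m + r * x" "b = m' + r' * x"
      unfolding J_def by blast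
    then have "a + b = (m + m') + (r + r') * x" by (simp add: algebra_simps)
    then show "a + b \<in> J"
      unfolding J_def using max_ideal_add[OF *] by blast
  next
    fix c a assume "a \<in> J"
    then obtain m r where *: "m \<in> max_ideal" and "a = m + r * x"
      unfolding J_def by blast
    then have "c * a = c * m + (c * r) * x" by (simp add: algebra_simps)
    then show "c * a \<in> J"
      unfolding J_def using max_ideal_mult[OF *] by blast
  qed
  moreover have "max_ideal \<subseteq> J"
  proof
    fix m assume "m \<in> max_ideal"
    moreover have "m = m + 0 * x" by simp
    ultimately show "m \<in> J"
      unfolding J_def by blast
  qed
  moreover have "x \<in> J"
  proof -
    have "x = 0 + 1 * x" by simp
    then show ?thesis
      unfolding J_def using max_ideal_zero by blast
  qed
  ultimately have "J = UNIV"
    using max_ideal assms unfolding maximal_ring_ideal_def by blast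
  then have "1 \<in> J" by simp
  then obtain m r where "1 = m + r * x" "m \<in> max_ideal"
    unfolding J_def by blast
  then have "r * x - 1 = - m" by (simp add: algebra_simps)
  with \<open>m \<in> max_ideal\<close> show ?thesis
    by (intro exI[of _ r]) (simp add: max_ideal_uminus)
qed

end

quotient_type (overloaded) 'a residue = "'a :: finite_local_pir2" / "\<lambda>x y. x - y \<in> max_ideal"
  morphisms rep_residue to_residue
proof (rule equivpI)
  show "reflp (\<lambda>x y :: 'a. x - y \<in> max_ideal)"
    by (simp add: reflp_def)
  show "symp (\<lambda>x y :: 'a. x - y \<in> max_ideal)"
    by (rule sympI) (use max_ideal_uminus in fastforce)
  show "transp (\<lambda>x y :: 'a. x - y \<in> max_ideal)"
    by (rule transpI) (use max_ideal_add in fastforce)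
qed

instantiation residue :: (finite_local_pir2) comm_ring_1
begin

lift_definition zero_residue :: "'a residue" is 0 .
lift_definition one_residue :: "'a residue" is 1 .
lift_definition plus_residue :: "'a residue \<Rightarrow> 'a residue \<Rightarrow> 'a residue" is "(+)"
proof -
  fix a b c d :: 'a
  assume "a - b \<in> max_ideal" "c - d \<in> max_ideal"
  from max_ideal_add[OF this] show "a + c - (b + d) \<in> max_ideal"
    by (simp add: algebra_simps)
qed
lift_definition uminus_residue :: "'a residue \<Rightarrow> 'a residue" is uminus
proof -
  fix a b :: 'a
  assume "a - b \<in> max_ideal"
  from max_ideal_uminus[OF this] show "- a - - b \<in> max_ideal"
    by simp
qed
lift_definition minus_residue :: "'a residue \<Rightarrow> 'a residue \<Rightarrow> 'a residue" is "(-)"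
proof -
  fix a b c d :: 'a
  assume "a - b \<in> max_ideal" "c - d \<in> max_ideal"
  from max_ideal_diff[OF this] show "a - c - (b - d) \<in> max_ideal"
    by (simp add: algebra_simps)
qed
lift_definition times_residue :: "'a residue \<Rightarrow> 'a residue \<Rightarrow> 'a residue" is "(*)"
proof -
  fix a b c d :: 'a
  assume "a - b \<in> max_ideal" "c - d \<in> max_ideal"
  then have "c * (a - b) + b * (c - d) \<in> max_ideal"
    by (intro max_ideal_add max_ideal_mult)
  then show "a * c - b * d \<in> max_ideal" by (simp add: algebra_simps)
qed

instance
proof
  fix a b c :: "'a residue"
  show "a + b + c = a + (b + c)" by transfer (simp add: add.assoc)
  show "a + b = b + a" by transfer (simp add: add.commute)
  show "0 + a = a" by transfer simp
  show "- a + a = 0" by transfer simp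
  show "a - b = a + - b" by transfer simp
  show "a * b * c = a * (b * c)" by transfer (simp add: mult.assoc)
  show "a * b = b * a" by transfer (simp add: mult.commute)
  show "1 * a = a" by transfer simp
  show "(a + b) * c = a * c + b * c" by transfer (simp add: distrib_right)
  show "(0 :: 'a residue) \<noteq> 1"
  proof transfer
    show "(0 :: 'a) - 1 \<notin> max_ideal"
      using one_notin_max_ideal max_ideal_uminus[of "- 1 :: 'a"] by auto
  qed
qed

end

instantiation residue :: (finite_local_pir2) field
begin

definition inverse_residue :: "'a residue \<Rightarrow> 'a residue" where
  "inverse_residue x = (if x = 0 then 0 else (SOME y. y * x = 1))"

definition divide_residue :: "'a residue \<Rightarrow> 'a residue \<Rightarrow> 'a residue" where
  "divide_residue x y = x * inverse y"

instance
proof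
  fix x y :: "'a residue"
  have "x \<noteq> 0 \<Longrightarrow> \<exists>y. y * x = 1"
    by transfer (simp add: inverse_mod_max_ideal)
  then show "x \<noteq> 0 \<Longrightarrow> inverse x * x = 1"
    unfolding inverse_residue_def by (auto intro: someI_ex)
  show "x div y = x * inverse y" by (fact divide_residue_def)
  show "inverse (0 :: 'a residue) = 0" by (simp add: inverse_residue_def)
qed

end

abbreviation reduce_poly :: "'a :: finite_local_pir2 poly \<Rightarrow> 'a residue poly" where
  "reduce_poly \<equiv> map_poly to_residue"

abbreviation reduce_mat :: "'a :: finite_local_pir2 mat \<Rightarrow> 'a residue mat" where
  "reduce_mat \<equiv> map_mat to_residue"

definition GL :: "nat \<Rightarrow> 'a :: comm_ring_1 mat set" where
  "GL n = {A \<in> carrier_mat n n. invertible_mat A}"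

definition separable_poly :: "'a :: field poly \<Rightarrow> bool" where
  "separable_poly f \<longleftrightarrow> coprime f (pderiv f)"

definition regular_semisimple :: "'a :: finite_local_pir2 mat \<Rightarrow> bool" where
  "regular_semisimple A \<longleftrightarrow> separable_poly (char_poly (reduce_mat A))"

definition monic_fundamental_irreducible :: "'a :: finite_local_pir2 poly \<Rightarrow> bool" where
  "monic_fundamental_irreducible F \<longleftrightarrow> monic F \<and> irreducible (reduce_poly F)"

text \<open>The polynomial ring over a ring with zero divisors is no integral domain, so that
  coprimality is expressed by the Bezout identity.\<close>

definition comaximal :: "'a :: comm_ring_1 \<Rightarrow> 'a \<Rightarrow> bool" where
  "comaximal x y \<longleftrightarrow> (\<exists>u v. u * x + v * y = 1)"

text \<open>Pairwise coprime non-units are distinct, hence a set of factors suffices.\<close>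

definition fundamental_factorization ::
    "'a :: finite_local_pir2 poly \<Rightarrow> 'a poly set \<Rightarrow> bool" where
  "fundamental_factorization P S \<longleftrightarrow>
     finite S \<and> (\<forall>F\<in>S. monic_fundamental_irreducible F) \<and> pairwise comaximal S \<and> \<Prod>S = P"

definition fundamental_irreducible_factor ::
    "'a :: finite_local_pir2 poly \<Rightarrow> 'a poly \<Rightarrow> bool" where
  "fundamental_irreducible_factor F P \<longleftrightarrow> (\<exists>S. fundamental_factorization P S \<and> F \<in> S)"

text \<open>The polynomial \<open>F(t\<^sup>L)\<close> need not have separable reduction; a factor \<open>G\<close> of it is
  just a divisor.\<close>

definition L_power_polynomial :: "nat \<Rightarrow> 'a :: finite_local_pir2 poly \<Rightarrow> bool" where
  "L_power_polynomial L F \<longleftrightarrow>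
     monic_fundamental_irreducible F \<and>
     (\<exists>G. monic_fundamental_irreducible G \<and> G dvd pcompose F (monom 1 L) \<and>
          degree G = degree F)"

end

theory Submission
  imports Defs
begin

text \<open>Write \<open>R\<close> for the local ring, \<open>\<mm>\<close> for its maximal ideal, \<open>k\<close> for the residue field and \<open>\<chi>\<close> for the
  characteristic polynomial of \<open>A\<close>. Everything that matters happens over \<open>k\<close>; the passage to \<open>R\<close> is
  Hensel's lemma, which for \<open>\<mm>\<^sup>2 = 0\<close> is a single linear correction (\<open>hensel_lifting\<close>). It also shows that
  \<open>\<chi>\<close> has a factorization into fundamental irreducible polynomials
  (\<open>fundamental_factorization_exists\<close>).

  Let \<open>B\<^sup>L = A\<close>, and let \<open>f\<close> be the reduction of a fundamental irreducible factor \<open>F\<close> of \<open>\<chi>\<close>. Over \<open>k\<close> the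
  eigenvalues of \<open>B\<close> are \<open>L\<close>-th roots of those of \<open>A\<close>, so the characteristic polynomial of \<open>B\<close> contains
  an irreducible factor of \<open>f(t\<^sup>L)\<close>, whose degree is at least the degree of \<open>f\<close>. These factors, one for
  each \<open>f\<close>, are coprime, and there is no room for a larger degree
  (\<open>matrix_root_irreducible_factors\<close>). Since \<open>\<chi>(0)\<close> is a unit and \<open>L\<close> is prime to \<open>p\<close>, the polynomial
  \<open>f(t\<^sup>L)\<close> is separable (\<open>separable_pcompose_monom\<close>), and its factor lifts to a factor of \<open>F(t\<^sup>L)\<close>.

  Conversely, the root is found as a polynomial in \<open>A\<close>, namely by solving \<open>Q\<^sup>L \<equiv> t\<close> modulo \<open>\<chi>\<close> and
  evaluating at \<open>A\<close> with the Cayley--Hamilton theorem (\<open>poly_value_char_poly\<close>). If \<open>g\<close> is an irreducible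
  factor of \<open>f(t\<^sup>L)\<close> of the same degree as \<open>f\<close>, then \<open>t \<mapsto> t\<^sup>L\<close> is an isomorphism between the finite
  fields \<open>k[t]/(f)\<close> and \<open>k[t]/(g)\<close>, which makes \<open>t\<close> an \<open>L\<close>-th power in the former
  (\<open>variable_is_power_mod\<close>). The Chinese remainder theorem combines the roots for all \<open>f\<close>, and the kernel
  of reduction, being killed by \<open>p\<close>, does not obstruct the extraction of \<open>L\<close>-th roots (\<open>root_lift\<close>).\<close>

section \<open>Comaximal elements\<close>

lemma comaximal_commute: "comaximal x y \<longleftrightarrow> comaximal y x"
  unfolding comaximal_def by (metis add.commute)

lemma comaximal_dvd_dvd:
  assumes "comaximal x y" "x' dvd x" "y' dvd y"
  shows "comaximal x' y'"
proof -
  obtain u v where "u * x + v * y = 1"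
    using assms(1) unfolding comaximal_def by blast
  moreover obtain a b where "x = x' * a" "y = y' * b"
    using assms(2,3) unfolding dvd_def by blast
  ultimately have "(u * a) * x' + (v * b) * y' = 1"
    by (simp add: ac_simps)
  then show ?thesis
    unfolding comaximal_def by blast
qed

lemma comaximal_if_unit:
  assumes "u * x + v * y dvd 1"
  shows "comaximal x y"
proof -
  obtain w where "1 = (u * x + v * y) * w"
    using assms unfolding dvd_def by blast
  then have "(u * w) * x + (v * w) * y = 1"
    by (simp add: algebra_simps)
  then show ?thesis
    unfolding comaximal_def by blast
qed

lemma comaximal_mult_right:
  assumes "comaximal x y" "comaximal x z"
  shows "comaximal x (y * z)"
proof -
  obtain a b c d where *: "a * x + b * y = 1" "c * x + d * z = 1"
    using assms unfolding comaximal_def by blast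
  have "(a * (c * x + d * z) + b * y * c) * x + (b * d) * (y * z)
      = (a * x + b * y) * (c * x + d * z)"
    by (simp add: algebra_simps)
  also have "\<dots> = 1"
    by (simp add: *)
  finally show ?thesis
    unfolding comaximal_def by blast
qed

lemma comaximal_one_right: "comaximal x 1"
  unfolding comaximal_def by (rule exI[of _ 0], rule exI[of _ 1]) simp

lemma comaximal_prod_right:
  assumes "\<And>i. i \<in> I \<Longrightarrow> comaximal x (f i)"
  shows "comaximal x (prod f I)"
  using assms
  by (induction I rule: infinite_finite_induct) (auto simp: comaximal_one_right comaximal_mult_right)

lemma comaximal_dvd_unit:
  assumes "comaximal x y" "z dvd x" "z dvd y"
  shows "z dvd 1"
  using assms unfolding comaximal_def by (metis dvd_add dvd_mult)

lemma comaximal_mult_dvd: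
  assumes "comaximal x y" "x dvd z" "y dvd z"
  shows "x * y dvd z"
proof -
  obtain u v where uv: "u * x + v * y = 1"
    using assms(1) unfolding comaximal_def by blast
  obtain a b where ab: "z = x * a" "z = y * b"
    using assms(2,3) unfolding dvd_def by blast
  have "z = u * x * z + v * y * z"
    using uv by (metis distrib_right mult_1)
  also have "\<dots> = u * x * (y * b) + v * y * (x * a)"
    using ab by simp
  also have "\<dots> = x * y * (u * b + v * a)"
    by (simp add: algebra_simps)
  finally show ?thesis
    by (rule dvdI)
qed

lemma pairwise_comaximal_prod_dvd:
  assumes "finite I" "\<And>i j. i \<in> I \<Longrightarrow> j \<in> I \<Longrightarrow> i \<noteq> j \<Longrightarrow> comaximal (f i) (f j)"
    and "\<And>i. i \<in> I \<Longrightarrow> f i dvd z"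
  shows "prod f I dvd z"
  using assms
proof (induction I)
  case (insert i I)
  have "comaximal (f i) (prod f I)"
    by (rule comaximal_prod_right) (use insert in auto)
  then show ?case
    using insert by (auto intro!: comaximal_mult_dvd)
qed simp

lemma comaximal_hom:
  assumes "comm_ring_hom h" "comaximal x y"
  shows "comaximal (h x) (h y)"
proof -
  interpret comm_ring_hom h by fact
  obtain u v where "u * x + v * y = 1"
    using assms(2) unfolding comaximal_def by blast
  then have "h u * h x + h v * h y = 1"
    by (metis hom_add hom_mult hom_one)
  then show ?thesis
    unfolding comaximal_def by blast
qed

lemma comaximal_pcompose:
  assumes "comaximal f g"
  shows "comaximal (pcompose f r) (pcompose g r)"
proof -
  obtain u v where "u * f + v * g = 1"
    using assms unfolding comaximal_def by blast
  then have "pcompose u r * pcompose f r + pcompose v r * pcompose g r = 1"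
    by (metis pcompose_1 pcompose_add pcompose_mult)
  then show ?thesis
    unfolding comaximal_def by blast
qed

lemma chinese_remainder_comaximal:
  assumes "finite I" "\<And>i j. i \<in> I \<Longrightarrow> j \<in> I \<Longrightarrow> i \<noteq> j \<Longrightarrow> comaximal (f i) (f j)"
  shows "\<exists>x. \<forall>i\<in>I. f i dvd x - a i"
  using assms
proof (induction I)
  case (insert i I)
  obtain x where x: "\<forall>j\<in>I. f j dvd x - a j"
    using insert by auto
  have "comaximal (f i) (prod f I)"
    by (rule comaximal_prod_right) (use insert in auto)
  then obtain u v where uv: "u * f i + v * prod f I = 1"
    unfolding comaximal_def by blast
  (* x stays correct modulo the factors in I, and becomes congruent to a i modulo f i because there
     the product of the f j is inverse to v *)
  define y where "y = x + v * prod f I * (a i - x)"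
  have "y - a i = (u * f i + v * prod f I) * (x - a i) + v * prod f I * (a i - x)"
    unfolding uv y_def by simp
  then have "y - a i = f i * (u * (x - a i))"
    by (simp add: algebra_simps)
  moreover have "f j dvd y - a j" if "j \<in> I" for j
  proof -
    have "y - a j = (x - a j) + prod f I * (v * (a i - x))"
      unfolding y_def by (simp add: algebra_simps)
    moreover have "f j dvd prod f I"
      using that insert.hyps(1) by (rule dvd_prodI[rotated])
    ultimately show ?thesis
      using x that by (metis dvd_add dvd_mult2)
  qed
  ultimately show ?case
    by (intro exI[of _ y]) auto
qed simp

section \<open>Polynomials over a field\<close>

text \<open>Euclid's algorithm, with \<open>g = 0\<close> as its last step; the induction measure puts the zero
  polynomial below the nonzero constants.\<close>

lemma field_poly_bezout:
  fixes f g :: "'a :: field poly"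
  shows "\<exists>u v. u * f + v * g dvd f \<and> u * f + v * g dvd g"
proof (induction "if g = 0 then 0 else Suc (degree g)" arbitrary: f g rule: less_induct)
  case less
  show ?case
  proof (cases "g = 0")
    case True
    then show ?thesis
      by (intro exI[of _ 1] exI[of _ 0]) simp
  next
    case False
    obtain k r where f: "f = k * g + r" and r: "r = 0 \<or> degree r < degree g"
      using degree_mod_less[OF False, of f] div_mult_mod_eq[of f g] by metis
    have "(if r = 0 then 0 else Suc (degree r)) < (if g = 0 then 0 else Suc (degree g))"
      using r False by auto
    from less[OF this] obtain u v where uv: "u * g + v * r dvd g" "u * g + v * r dvd r"
      by blast
    have "v * f + (u - v * k) * g = u * g + v * r"
      unfolding f by (simp add: algebra_simps)
    moreover have "u * g + v * r dvd f"
      unfolding f using uv by (intro dvd_add dvd_mult)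
    ultimately show ?thesis
      using uv(1) by (intro exI[of _ v] exI[of _ "u - v * k"]) simp
  qed
qed

lemma irreducible_comaximal:
  fixes f g :: "'a :: field poly"
  assumes "irreducible f" "\<not> f dvd g"
  shows "comaximal f g"
proof -
  obtain u v where uv: "u * f + v * g dvd f" "u * f + v * g dvd g"
    using field_poly_bezout by blast
  then obtain c where c: "f = (u * f + v * g) * c"
    unfolding dvd_def by blast
  have "\<not> c dvd 1"
  proof
    assume "c dvd 1"
    then have "f dvd u * f + v * g"
      using c mult_unit_dvd_iff[of c "u * f + v * g" "u * f + v * g"] by simp
    then show False
      using uv(2) assms(2) dvd_trans by blast
  qed
  then have "u * f + v * g dvd 1"
    using irreducibleD[OF assms(1) c] by blast
  then show ?thesis
    by (rule comaximal_if_unit)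
qed

lemma irreducible_degree_one:
  fixes f :: "'a :: field poly"
  assumes "degree f = 1"
  shows "irreducible f"
proof (rule irreducibleI)
  fix a b assume ab: "f = a * b"
  then have "a \<noteq> 0" "b \<noteq> 0"
    using assms by auto
  then show "a dvd 1 \<or> b dvd 1"
    using assms by (auto simp: ab degree_mult_eq is_unit_iff_degree)
qed (use assms in \<open>auto simp: is_unit_iff_degree\<close>)

text \<open>A non-unit divisor of least degree is irreducible.\<close>

lemma monic_irreducible_dvd:
  fixes f :: "'a :: field poly"
  assumes "\<not> f dvd 1"
  shows "\<exists>g. monic g \<and> irreducible g \<and> g dvd f"
proof (cases "f = 0")
  case True
  have "irreducible [:0, 1 :: 'a:]"
    by (rule irreducible_degree_one) simp
  then show ?thesis
    using True by (intro exI[of _ "[:0,1:]"]) auto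
next
  case False
  define P where "P g \<longleftrightarrow> g dvd f \<and> \<not> g dvd 1" for g
  define g where "g = arg_min degree P"
  have "P f"
    using assms by (simp add: P_def)
  then have g: "P g" and min: "\<And>h. P h \<Longrightarrow> degree g \<le> degree h"
    unfolding g_def by (auto intro: arg_min_natI arg_min_nat_le)
  have g0: "g \<noteq> 0"
    using g False by (auto simp: P_def)
  have "irreducible g"
  proof (rule irreducibleI)
    fix a b assume ab: "g = a * b"
    show "a dvd 1 \<or> b dvd 1"
    proof (rule ccontr)
      assume "\<not> ?thesis"
      then have "P a" "degree b \<noteq> 0"
        using g g0 unfolding P_def ab by (auto dest: dvd_mult_left simp: is_unit_iff_degree)
      then show False
        using min[of a] g0 by (simp add: ab degree_mult_eq)
    qed
  qed (use g g0 in \<open>auto simp: P_def\<close>)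
  define c where "c = inverse (lead_coeff g)"
  have c: "c \<noteq> 0"
    using g0 by (simp add: c_def)
  have "monic (Polynomial.smult c g)"
    using g0 by (simp add: c_def)
  moreover have "irreducible (Polynomial.smult c g)"
    using \<open>irreducible g\<close> c by simp
  moreover have "Polynomial.smult c g dvd f"
    using g c by (simp add: P_def smult_dvd_iff)
  ultimately show ?thesis
    by blast
qed

lemma not_comaximal_common_irreducible:
  fixes f g :: "'a :: field poly"
  assumes "\<not> comaximal f g"
  shows "\<exists>h. monic h \<and> irreducible h \<and> h dvd f \<and> h dvd g"
proof -
  obtain u v where uv: "u * f + v * g dvd f" "u * f + v * g dvd g"
    using field_poly_bezout by blast
  have "\<not> u * f + v * g dvd 1"
    using assms comaximal_if_unit by blast
  then obtain h where "monic h" "irreducible h" "h dvd u * f + v * g"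
    using monic_irreducible_dvd by blast
  then show ?thesis
    using uv by (intro exI[of _ h]) (auto elim: dvd_trans)
qed

lemma coprime_iff_comaximal:
  fixes f g :: "'a :: field poly"
  shows "coprime f g \<longleftrightarrow> comaximal f g"
proof
  assume coprime: "coprime f g"
  show "comaximal f g"
  proof (rule ccontr)
    assume "\<not> comaximal f g"
    then obtain h where h: "irreducible h" "h dvd f" "h dvd g"
      using not_comaximal_common_irreducible by blast
    from coprime_common_divisor[OF coprime h(2,3)] h(1) show False
      by (simp add: irreducible_def)
  qed
next
  assume "comaximal f g"
  then show "coprime f g"
    by (intro coprimeI) (rule comaximal_dvd_unit)
qed

lemma separable_mult_comaximal:
  fixes f g :: "'a :: field poly"
  assumes "separable_poly (f * g)"
  shows "comaximal f g"
proof (rule ccontr)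
  assume "\<not> comaximal f g"
  then obtain h where h: "irreducible h" "h dvd f" "h dvd g"
    using not_comaximal_common_irreducible by blast
  then have "h dvd f * g" "h dvd pderiv (f * g)"
    by (simp_all add: pderiv_mult)
  from coprime_common_divisor[OF assms[unfolded separable_poly_def] this] h(1) show False
    by (simp add: irreducible_def)
qed

lemma separable_poly_dvd:
  fixes f g :: "'a :: field poly"
  assumes "separable_poly g" "f dvd g"
  shows "separable_poly f"
proof -
  obtain h where h: "g = f * h"
    using assms(2) by blast
  obtain u v where "u * g + v * pderiv g = 1"
    using assms(1) unfolding separable_poly_def coprime_iff_comaximal comaximal_def by blast
  then have "(u * h + v * pderiv h) * f + (v * h) * pderiv f = 1"
    by (simp add: h pderiv_mult algebra_simps)
  then show ?thesis
    unfolding separable_poly_def coprime_iff_comaximal comaximal_def by blast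
qed

section \<open>Substituting a power of the variable\<close>

lemma coeff_pcompose_monom_multiple:
  assumes "k > 0"
  shows "coeff (pcompose p (monom 1 k)) (k * i) = coeff (p :: 'a :: comm_semiring_1 poly) i"
proof (induction p arbitrary: i)
  case (pCons a p)
  show ?case
    using assms pCons.IH
    by (cases i) (auto simp: pcompose_pCons coeff_monom_mult coeff_pCons split: nat.split)
qed simp

lemma monic_pcompose_monom:
  fixes F :: "'a :: comm_ring_1 poly"
  assumes "monic F" "k > 0"
  shows "monic (pcompose F (monom 1 k))"
proof -
  have "coeff (pcompose F (monom 1 k)) (k * degree F) = 1"
    using assms by (simp add: coeff_pcompose_monom_multiple)
  moreover have "degree (pcompose F (monom 1 k)) \<le> k * degree F"
    using degree_pcompose_le[of F "monom 1 k"] degree_monom_le[of "1 :: 'a" k]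
    by (metis le_trans mult.commute mult_le_mono1)
  moreover have "k * degree F \<le> degree (pcompose F (monom 1 k))"
    using calculation(1) by (intro le_degree) simp
  ultimately show ?thesis
    by simp
qed

text \<open>A common irreducible factor of \<open>f(t\<^sup>L)\<close> and its derivative \<open>L t\<^sup>L\<^sup>-\<^sup>1 f'(t\<^sup>L)\<close> would divide \<open>t\<close>,
  since \<open>f\<close> and \<open>f'\<close> stay comaximal after the substitution and \<open>L\<close> is invertible; but \<open>f(t\<^sup>L)\<close> does not vanish at \<open>0\<close>.\<close>

lemma separable_pcompose_monom:
  fixes f :: "'a :: field poly"
  assumes "separable_poly f" "coeff f 0 \<noteq> 0" "of_nat L \<noteq> (0 :: 'a)"
  shows "separable_poly (pcompose f (monom 1 L))"
proof -
  have L: "L > 0"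
    using assms(3) by (cases L) auto
  let ?g = "pcompose f (monom 1 L)"
  have "comaximal ?g (pcompose (pderiv f) (monom 1 L))"
    using assms(1) unfolding separable_poly_def coprime_iff_comaximal by (rule comaximal_pcompose)
  moreover have "comaximal ?g (pderiv (monom 1 L))"
  proof (rule ccontr)
    assume "\<not> ?thesis"
    then obtain h where h: "irreducible h" "h dvd ?g" "h dvd monom (of_nat L) (L - 1)"
      using not_comaximal_common_irreducible by (force simp: pderiv_monom)
    have "monom (of_nat L :: 'a) (L - 1) = Polynomial.smult (of_nat L) (monom 1 1 ^ (L - 1))"
      by (simp add: smult_monom monom_power)
    then have hX: "h dvd monom 1 1 ^ (L - 1)"
      using h(3) assms(3) by (simp add: dvd_smult_iff)
    have "comaximal (monom 1 1) ?g"
    proof (rule irreducible_comaximal)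
      show "irreducible (monom (1 :: 'a) 1)"
        by (rule irreducible_degree_one) (simp add: degree_monom_eq)
      have "coeff ?g 0 \<noteq> 0"
        using L assms(2) unfolding coeff_pcompose_0 by (simp add: poly_0_coeff_0)
      then show "\<not> monom 1 1 dvd ?g"
        by (simp add: monom_1_dvd_iff')
    qed
    then have "comaximal ?g (\<Prod>i<L - 1. monom 1 1)"
      by (intro comaximal_prod_right) (simp add: comaximal_commute)
    then show False
      using h hX comaximal_dvd_unit[of ?g _ h] unfolding irreducible_def by simp
  qed
  ultimately show ?thesis
    unfolding separable_poly_def coprime_iff_comaximal pderiv_pcompose
    by (rule comaximal_mult_right)
qed

text \<open>The reason is that \<open>g\<close> divides \<open>f(t\<^sup>L)\<close>, so that \<open>t \<mapsto> t\<^sup>L\<close> induces a ring homomorphism between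
  the fields \<open>k[t]/(f)\<close> and \<open>k[t]/(g)\<close>, which is injective. The fields are represented by the
  remainders of division.\<close>

lemma power_subst_mod_inj:
  fixes f g :: "'a :: field poly"
  assumes f: "irreducible f" and g: "irreducible g" "g dvd pcompose f (monom 1 L)"
  shows "inj_on (\<lambda>r. pcompose r (monom 1 L) mod g) {r. r = 0 \<or> degree r < degree f}"
proof (rule inj_onI)
  fix r s
  assume rs: "r \<in> {r. r = 0 \<or> degree r < degree f}" "s \<in> {r. r = 0 \<or> degree r < degree f}"
    and "pcompose r (monom 1 L) mod g = pcompose s (monom 1 L) mod g"
  then have dvd: "g dvd pcompose (r - s) (monom 1 L)"
    by (simp add: pcompose_diff mod_eq_dvd_iff)
  have "f dvd r - s"
  proof (rule ccontr)
    assume "\<not> f dvd r - s"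
    from comaximal_dvd_unit[OF comaximal_pcompose[OF irreducible_comaximal[OF f this]] g(2) dvd]
    show False
      using g(1) by (simp add: irreducible_def)
  qed
  show "r = s"
  proof (rule ccontr)
    assume "r \<noteq> s"
    then have "degree f \<le> degree (r - s)"
      using \<open>f dvd r - s\<close> by (simp add: dvd_imp_degree_le)
    moreover have "degree (r - s) < degree f"
      using rs \<open>r \<noteq> s\<close> degree_diff_less[of r "degree f" s] by (auto simp: degree_diff_less)
    ultimately show False
      by simp
  qed
qed

lemma finite_polys_degree_less:
  assumes "finite (UNIV :: 'a :: zero set)"
  shows "finite {r :: 'a poly. r = 0 \<or> degree r < n}"
proof (rule finite_subset)
  show "{r :: 'a poly. r = 0 \<or> degree r < n} \<subseteq> Poly ` {xs. set xs \<subseteq> UNIV \<and> length xs \<le> n}"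
  proof
    fix r :: "'a poly"
    assume "r \<in> {r. r = 0 \<or> degree r < n}"
    then have "length (coeffs r) \<le> n"
      by (cases "r = 0") (auto simp: length_coeffs_degree)
    then show "r \<in> Poly ` {xs. set xs \<subseteq> UNIV \<and> length xs \<le> n}"
      by (intro image_eqI[of _ _ "coeffs r"]) auto
  qed
qed (use finite_lists_length_le[OF assms] in simp)

lemma mod_polys_degree_less:
  fixes g :: "'a :: field poly"
  assumes "irreducible g"
  shows "h mod g \<in> {r. r = 0 \<or> degree r < degree g}"
  using assms degree_mod_less[of g h] by auto

text \<open>The field \<open>k[t]/(f)\<close> embeds into \<open>k[t]/(g)\<close>, and over a finite field the degrees can be compared
  by counting remainders.\<close>

lemma degree_le_of_dvd_power_subst:
  fixes f g :: "'a :: field poly"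
  assumes fin: "finite (UNIV :: 'a set)"
    and f: "irreducible f" and g: "irreducible g" "g dvd pcompose f (monom 1 L)"
  shows "degree f \<le> degree g"
proof (rule ccontr)
  assume less: "\<not> degree f \<le> degree g"
  let ?P = "\<lambda>h :: 'a poly. {r :: 'a poly. r = 0 \<or> degree r < degree h}"
  have "card (?P f) \<le> card (?P g)"
  proof (rule card_inj_on_le[OF power_subst_mod_inj[OF f g]])
    show "(\<lambda>r. pcompose r (monom 1 L) mod g) ` ?P f \<subseteq> ?P g"
      using mod_polys_degree_less[OF g(1)] by blast
  qed (rule finite_polys_degree_less[OF fin])
  moreover have "?P g \<subset> ?P f"
  proof
    show "?P g \<noteq> ?P f"
      using less g(1) by (auto simp: set_eq_iff irreducible_def intro!: exI[of _ g])
  qed (use less in auto)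
  then have "card (?P g) < card (?P f)"
    by (rule psubset_card_mono[OF finite_polys_degree_less[OF fin]])
  ultimately show False
    by simp
qed

lemma pcompose_X: "pcompose (monom 1 1) r = (r :: 'a :: comm_semiring_1 poly)"
proof -
  have "monom 1 1 = [:0, 1 :: 'a:]"
    by (simp add: monom_Suc monom_0)
  then show ?thesis
    by (simp only: pcompose_pCons) simp
qed

text \<open>Between finite fields of equal size the embedding \<open>t \<mapsto> t\<^sup>L\<close> is bijective. A preimage \<open>q\<close> of \<open>t\<close>
  satisfies \<open>q\<^sup>L \<mapsto> t\<^sup>L\<close>, and \<open>t\<close> is another preimage of \<open>t\<^sup>L\<close>; hence \<open>q\<^sup>L = t\<close> in \<open>k[t]/(f)\<close>.\<close>

lemma variable_is_power_mod:
  fixes f g :: "'a :: field poly"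
  assumes fin: "finite (UNIV :: 'a set)"
    and f: "irreducible f" and g: "irreducible g" "g dvd pcompose f (monom 1 L)"
    and deg: "degree g = degree f"
  shows "\<exists>q. f dvd q ^ L - monom 1 1"
proof -
  let ?P = "{r. r = 0 \<or> degree r < degree f}"
  let ?h = "\<lambda>r. pcompose r (monom 1 L) mod g"
  have "?h ` ?P \<subseteq> ?P"
    using mod_polys_degree_less[OF g(1)] by (auto simp: deg)
  then have "?h ` ?P = ?P"
    by (intro endo_inj_surj finite_polys_degree_less[OF fin] power_subst_mod_inj[OF f g])
  moreover have "monom 1 1 mod g \<in> ?P"
    using mod_polys_degree_less[OF g(1)] by (simp add: deg)
  ultimately obtain q where "monom 1 1 mod g = pcompose q (monom 1 L) mod g"
    by (metis (no_types, lifting) image_iff)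
  then have "pcompose q (monom 1 L) ^ L mod g = monom 1 1 ^ L mod g"
    by (metis power_mod)
  then have dvd: "g dvd pcompose (q ^ L - monom 1 1) (monom 1 L)"
    by (simp add: pcompose_diff pcompose_hom.hom_power mod_eq_dvd_iff monom_power pcompose_X[simplified])
  have "f dvd q ^ L - monom 1 1"
  proof (rule ccontr)
    assume "\<not> ?thesis"
    from comaximal_dvd_unit[OF comaximal_pcompose[OF irreducible_comaximal[OF f this]] g(2) dvd]
    show False
      using g(1) by (simp add: irreducible_def)
  qed
  then show ?thesis ..
qed

lemma pCons_eq_monom: "pCons a p = [:a:] + monom 1 1 * (p :: 'a :: comm_semiring_1 poly)"
proof -
  have "monom 1 1 = [:0, 1 :: 'a:]"
    by (simp add: monom_Suc monom_0)
  then show ?thesis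
    by simp
qed

section \<open>Values of polynomials at matrices\<close>

definition const_mat :: "'a :: comm_ring_1 mat \<Rightarrow> 'a poly mat" where
  "const_mat M = map_mat (\<lambda>a. [:a:]) M"

text \<open>The matrix \<open>M\<close> is \<open>p(A)\<close>, expressed as the remainder of the polynomial matrix \<open>p \<cdot> I\<close> under left
  division by \<open>t I - A\<close>. In this form the Cayley--Hamilton theorem is the adjugate identity, and
  compatibility with products holds over any commutative ring.\<close>

definition poly_value :: "nat \<Rightarrow> 'a :: comm_ring_1 mat \<Rightarrow> 'a poly \<Rightarrow> 'a mat \<Rightarrow> bool" where
  "poly_value n A p M \<longleftrightarrow> M \<in> carrier_mat n n \<and>
     (\<exists>Q \<in> carrier_mat n n. p \<cdot>\<^sub>m 1\<^sub>m n = const_mat M + char_poly_matrix A * Q)"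

lemma const_mat_carrier [simp]: "const_mat M \<in> carrier_mat n m \<longleftrightarrow> M \<in> carrier_mat n m"
  by (simp add: const_mat_def)

lemma const_hom: "comm_ring_hom (\<lambda>a :: 'a :: comm_ring_1. [:a:])"
  by unfold_locales (simp_all add: one_pCons)

lemma const_mat_mult:
  assumes "M \<in> carrier_mat n n" "N \<in> carrier_mat n n"
  shows "const_mat (M * N) = const_mat M * const_mat N"
proof -
  interpret comm_ring_hom "\<lambda>a :: 'a. [:a:]"
    by (rule const_hom)
  show ?thesis
    unfolding const_mat_def using assms by (rule mat_hom_mult)
qed

lemma const_mat_add:
  assumes "M \<in> carrier_mat n n" "N \<in> carrier_mat n n"
  shows "const_mat (M + N) = const_mat M + const_mat N"
  using assms by (intro eq_matI) (auto simp: const_mat_def)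

lemma poly_value_carrier: "poly_value n A p M \<Longrightarrow> M \<in> carrier_mat n n"
  by (simp add: poly_value_def)

lemma poly_value_add:
  assumes A: "A \<in> carrier_mat n n" and "poly_value n A p M" "poly_value n A q N"
  shows "poly_value n A (p + q) (M + N)"
proof -
  let ?T = "char_poly_matrix A"
  have T: "?T \<in> carrier_mat n n"
    using A by simp
  obtain Q R where QR: "Q \<in> carrier_mat n n" "R \<in> carrier_mat n n"
    and eq: "p \<cdot>\<^sub>m 1\<^sub>m n = const_mat M + ?T * Q" "q \<cdot>\<^sub>m 1\<^sub>m n = const_mat N + ?T * R"
    and MN: "M \<in> carrier_mat n n" "N \<in> carrier_mat n n"
    using assms unfolding poly_value_def by blast
  have "(p + q) \<cdot>\<^sub>m 1\<^sub>m n = p \<cdot>\<^sub>m 1\<^sub>m n + q \<cdot>\<^sub>m 1\<^sub>m n"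
    by (rule add_smult_distrib_right_mat[where nr = n and nc = n]) simp
  also have "\<dots> = (const_mat M + const_mat N) + (?T * Q + ?T * R)"
    unfolding eq using T QR MN by (intro eq_matI) (auto simp: algebra_simps)
  also have "\<dots> = const_mat (M + N) + ?T * (Q + R)"
    using MN T QR by (simp add: const_mat_add mult_add_distrib_mat[of _ n n])
  finally show ?thesis
    unfolding poly_value_def using MN QR by (intro conjI bexI[of _ "Q + R"]) auto
qed

lemma poly_value_mult:
  assumes A: "A \<in> carrier_mat n n" and "poly_value n A p M" "poly_value n A q N"
  shows "poly_value n A (p * q) (M * N)"
proof -
  let ?T = "char_poly_matrix A"
  have T: "?T \<in> carrier_mat n n"
    using A by simp
  obtain Q R where QR: "Q \<in> carrier_mat n n" "R \<in> carrier_mat n n"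
    and eq: "p \<cdot>\<^sub>m 1\<^sub>m n = const_mat M + ?T * Q" "q \<cdot>\<^sub>m 1\<^sub>m n = const_mat N + ?T * R"
    and MN: "M \<in> carrier_mat n n" "N \<in> carrier_mat n n"
    using assms unfolding poly_value_def by blast
  have cN: "const_mat N \<in> carrier_mat n n" "const_mat M \<in> carrier_mat n n"
    using MN by simp_all
  have "(p * q) \<cdot>\<^sub>m 1\<^sub>m n = p \<cdot>\<^sub>m (q \<cdot>\<^sub>m 1\<^sub>m n)"
    by (rule eq_matI) auto
  also have "\<dots> = p \<cdot>\<^sub>m const_mat N + p \<cdot>\<^sub>m (?T * R)"
    unfolding eq using cN T QR by (intro add_smult_distrib_left_mat) auto
  also have "p \<cdot>\<^sub>m const_mat N = (p \<cdot>\<^sub>m 1\<^sub>m n) * const_mat N"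
    using cN by (simp add: mult_smult_assoc_mat[of _ n n _ n])
  also have "\<dots> = const_mat M * const_mat N + ?T * Q * const_mat N"
    unfolding eq using cN T QR by (intro add_mult_distrib_mat) auto
  also have "?T * Q * const_mat N = ?T * (Q * const_mat N)"
    using cN T QR by simp
  also have "p \<cdot>\<^sub>m (?T * R) = ?T * (p \<cdot>\<^sub>m R)"
    using T QR by (simp add: mult_smult_distrib[of _ n n])
  also have "const_mat M * const_mat N + ?T * (Q * const_mat N) + ?T * (p \<cdot>\<^sub>m R)
      = const_mat M * const_mat N + (?T * (Q * const_mat N) + ?T * (p \<cdot>\<^sub>m R))"
    using cN T QR by (intro assoc_add_mat[of _ n n]) (auto intro!: mult_carrier_mat)
  also have "\<dots> = const_mat (M * N) + ?T * (Q * const_mat N + p \<cdot>\<^sub>m R)"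
    using cN T QR MN
    by (subst mult_add_distrib_mat[of _ n n]) (auto simp: const_mat_mult intro!: mult_carrier_mat)
  finally show ?thesis
    unfolding poly_value_def using MN QR cN
    by (intro conjI bexI[of _ "Q * const_mat N + p \<cdot>\<^sub>m R"]) auto
qed

lemma poly_value_const:
  assumes A: "A \<in> carrier_mat n n"
  shows "poly_value n A [:c:] (c \<cdot>\<^sub>m 1\<^sub>m n)"
  unfolding poly_value_def
proof (intro conjI bexI)
  have "char_poly_matrix A * 0\<^sub>m n n = 0\<^sub>m n n"
    using char_poly_matrix_closed[OF A] by (rule right_mult_zero_mat)
  then show "[:c:] \<cdot>\<^sub>m 1\<^sub>m n = const_mat (c \<cdot>\<^sub>m 1\<^sub>m n) + char_poly_matrix A * 0\<^sub>m n n"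
    by (simp only:) (rule eq_matI, auto simp: const_mat_def)
qed auto

lemma poly_value_variable:
  assumes A: "A \<in> carrier_mat n n"
  shows "poly_value n A (monom 1 1) A"
  unfolding poly_value_def
proof (intro conjI bexI)
  have "char_poly_matrix A * 1\<^sub>m n = char_poly_matrix A"
    using char_poly_matrix_closed[OF A] by (rule right_mult_one_mat)
  then show "monom 1 1 \<cdot>\<^sub>m 1\<^sub>m n = const_mat A + char_poly_matrix A * 1\<^sub>m n"
    using A by (simp only:) (rule eq_matI, auto simp: const_mat_def char_poly_matrix_def monom_Suc monom_0)
qed (use A in auto)

text \<open>The Cayley--Hamilton theorem, from \<open>(t I - A) adj(t I - A) = \<chi>\<^sub>A I\<close>.\<close>

lemma poly_value_char_poly:
  assumes A: "A \<in> carrier_mat n n"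
  shows "poly_value n A (char_poly A) (0\<^sub>m n n)"
  unfolding poly_value_def
proof (intro conjI bexI)
  have T: "char_poly_matrix A \<in> carrier_mat n n"
    using A by simp
  have "const_mat (0\<^sub>m n n) = (0\<^sub>m n n :: 'a poly mat)"
    by (rule eq_matI) (auto simp: const_mat_def)
  then show "char_poly A \<cdot>\<^sub>m 1\<^sub>m n = const_mat (0\<^sub>m n n) + char_poly_matrix A * adj_mat (char_poly_matrix A)"
    using adj_mat[OF T] T by (simp add: char_poly_def)
  show "adj_mat (char_poly_matrix A) \<in> carrier_mat n n"
    using adj_mat[OF T] by simp
qed simp

lemma poly_value_exists:
  assumes A: "A \<in> carrier_mat n n"
  shows "\<exists>M. poly_value n A p M"
proof (induction p)
  case 0
  show ?case
    using poly_value_const[OF A, of 0] by auto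
next
  case (pCons a p)
  then obtain M where M: "poly_value n A p M"
    by blast
  show ?case
    unfolding pCons_eq_monom[of a p]
    using poly_value_add[OF A poly_value_const[OF A] poly_value_mult[OF A poly_value_variable[OF A] M]]
    by blast
qed

lemma poly_value_power:
  assumes A: "A \<in> carrier_mat n n" and M: "poly_value n A p M"
  shows "poly_value n A (p ^ k) (M ^\<^sub>m k)"
proof (induction k)
  case 0
  have "1 \<cdot>\<^sub>m 1\<^sub>m n = (1\<^sub>m n :: 'a mat)"
    by (rule eq_matI) auto
  then show ?case
    using poly_value_const[OF A, of 1] poly_value_carrier[OF M] by (simp add: one_pCons)
next
  case (Suc k)
  then show ?case
    using poly_value_mult[OF A Suc M] by (simp add: mult.commute)
qed

text \<open>Both values are built by the same Horner steps, \<open>B\<^sup>k\<close> being the value of \<open>t\<close> at \<open>B\<^sup>k\<close> as well as of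
  \<open>t\<^sup>k\<close> at \<open>B\<close>.\<close>

lemma poly_value_pcompose_monom:
  assumes B: "B \<in> carrier_mat n n"
  shows "\<exists>M. poly_value n (B ^\<^sub>m k) p M \<and> poly_value n B (pcompose p (monom 1 k)) M"
proof (induction p)
  case 0
  show ?case
    using poly_value_const[OF B, of 0] poly_value_const[OF pow_carrier_mat[OF B], of k 0]
    by (intro exI[of _ "0 \<cdot>\<^sub>m 1\<^sub>m n"]) simp
next
  case (pCons a p)
  then obtain M where M: "poly_value n (B ^\<^sub>m k) p M" "poly_value n B (pcompose p (monom 1 k)) M"
    by blast
  note C = pow_carrier_mat[OF B, of k]
  have "poly_value n (B ^\<^sub>m k) (pCons a p) (a \<cdot>\<^sub>m 1\<^sub>m n + B ^\<^sub>m k * M)"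
    unfolding pCons_eq_monom[of a p]
    by (intro poly_value_add[OF C] poly_value_mult[OF C] poly_value_const[OF C]
        poly_value_variable[OF C] M(1))
  moreover have "poly_value n B (pcompose (pCons a p) (monom 1 k)) (a \<cdot>\<^sub>m 1\<^sub>m n + B ^\<^sub>m k * M)"
    using poly_value_power[OF B poly_value_variable[OF B], of k]
    unfolding pcompose_pCons
    by (intro poly_value_add[OF B] poly_value_mult[OF B] poly_value_const[OF B] M(2))
      (simp add: monom_power)
  ultimately show ?case
    by blast
qed

lemma coeff_char_poly_matrix_mult:
  assumes A: "A \<in> carrier_mat n n" and Q: "Q \<in> carrier_mat n n" and "i < n" "j < n"
  shows "coeff ((char_poly_matrix A * Q) $$ (i, j)) m =
    coeff (pCons 0 (Q $$ (i, j))) m - (\<Sum>l<n. A $$ (i, l) * coeff (Q $$ (l, j)) m)"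
proof -
  have "(char_poly_matrix A * Q) $$ (i, j) =
      ([:0, 1:] \<cdot>\<^sub>m 1\<^sub>m n * Q + map_mat (\<lambda>a. [:- a:]) A * Q) $$ (i, j)"
    using A Q unfolding char_poly_matrix_def by (subst add_mult_distrib_mat[of _ n n]) auto
  also have "[:0, 1:] \<cdot>\<^sub>m 1\<^sub>m n * Q = [:0, 1:] \<cdot>\<^sub>m Q"
    using Q by (simp add: mult_smult_assoc_mat[of _ n n _ n])
  also have "([:0, 1:] \<cdot>\<^sub>m Q + map_mat (\<lambda>a. [:- a:]) A * Q) $$ (i, j) =
      pCons 0 (Q $$ (i, j)) - (\<Sum>l<n. Polynomial.smult (A $$ (i, l)) (Q $$ (l, j)))"
    using assms
    by (simp add: scalar_prod_def lessThan_atLeast0 sum_negf)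
  finally show ?thesis
    by (simp add: coeff_sum)
qed

text \<open>A nonzero multiple of \<open>t I - A\<close> is never constant because the leading coefficient of \<open>t I - A\<close> is the
  identity: comparing coefficients from the top down shows that the quotients, and hence the
  remainders, agree.\<close>

lemma poly_value_unique:
  assumes A: "A \<in> carrier_mat n n" and "poly_value n A p M" "poly_value n A p N"
  shows "M = N"
proof -
  let ?T = "char_poly_matrix A"
  obtain Q R where QR: "Q \<in> carrier_mat n n" "R \<in> carrier_mat n n"
    and eq: "const_mat M + ?T * Q = const_mat N + ?T * R"
    and MN: "M \<in> carrier_mat n n" "N \<in> carrier_mat n n"
    using assms unfolding poly_value_def by metis
  have T: "?T \<in> carrier_mat n n"
    using A by simp
  have coeff_eq: "coeff [:M $$ (i, j):] m + coeff ((?T * Q) $$ (i, j)) m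
      = coeff [:N $$ (i, j):] m + coeff ((?T * R) $$ (i, j)) m" if "i < n" "j < n" for i j m
  proof -
    have "coeff ((const_mat M + ?T * Q) $$ (i, j)) m = coeff ((const_mat N + ?T * R) $$ (i, j)) m"
      by (simp only: eq)
    then show ?thesis
      using that MN QR T by (simp add: const_mat_def del: index_mult_mat(1))
  qed
  (* a common bound of all degrees, from which the descending induction starts *)
  define D where "D = Max ((\<lambda>(i, j). max (degree (Q $$ (i, j))) (degree (R $$ (i, j)))) ` ({..<n} \<times> {..<n}))"
  have D: "degree (Q $$ (i, j)) \<le> D" "degree (R $$ (i, j)) \<le> D" if "i < n" "j < n" for i j
  proof -
    have "max (degree (Q $$ (i, j))) (degree (R $$ (i, j))) \<le> D"
      unfolding D_def using that by (intro Max_ge) (auto intro!: image_eqI[of _ _ "(i, j)"])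
    then show "degree (Q $$ (i, j)) \<le> D" "degree (R $$ (i, j)) \<le> D"
      by simp_all
  qed
  have same: "coeff (Q $$ (i, j)) m = coeff (R $$ (i, j)) m" if "i < n" "j < n" for i j m
    using that
  proof (induction "Suc D - m" arbitrary: m i)
    case 0
    then show ?case
      using D[OF 0(2,3)] by (simp add: coeff_eq_0)
  next
    case (Suc d)
    have "coeff (Q $$ (l, j)) (Suc m) = coeff (R $$ (l, j)) (Suc m)" if "l < n" for l
      using Suc.hyps(2) that Suc.prems(2) by (intro Suc.hyps(1)) auto
    then show ?case
      using coeff_eq[OF Suc.prems, of "Suc m"] Suc.prems
      by (simp add: coeff_char_poly_matrix_mult[OF A] QR)
  qed
  show ?thesis
  proof (rule eq_matI)
    fix i j assume "i < dim_row N" "j < dim_col N"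
    then have ij: "i < n" "j < n"
      using MN by auto
    show "M $$ (i, j) = N $$ (i, j)"
      using coeff_eq[OF ij, of 0] ij same by (simp add: coeff_char_poly_matrix_mult[OF A] QR)
  qed (use MN in auto)
qed

lemma prod_diff_dvd:
  fixes a b :: "'i \<Rightarrow> 'a :: comm_ring_1"
  assumes "\<And>i. i \<in> I \<Longrightarrow> f dvd a i - b i"
  shows "f dvd prod a I - prod b I"
  using assms
proof (induction I rule: infinite_finite_induct)
  case (insert i I)
  have "prod a (insert i I) - prod b (insert i I)
      = a i * (prod a I - prod b I) + (a i - b i) * prod b I"
    using insert.hyps by (simp add: algebra_simps)
  then show ?case
    using insert by simp
qed auto

lemma det_diff_dvd:
  fixes M N :: "'a :: comm_ring_1 mat"
  assumes M: "M \<in> carrier_mat n n" and N: "N \<in> carrier_mat n n"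
    and dvd: "\<And>i j. i < n \<Longrightarrow> j < n \<Longrightarrow> f dvd M $$ (i, j) - N $$ (i, j)"
  shows "f dvd det M - det N"
  unfolding det_def'[OF M] det_def'[OF N] sum_subtractf[symmetric] right_diff_distrib[symmetric]
proof (intro dvd_sum dvd_mult prod_diff_dvd)
  fix \<pi> i assume "\<pi> \<in> {\<pi>. \<pi> permutes {0..<n}}" "i \<in> {0..<n}"
  then have "\<pi> i < n" "i < n"
    using permutes_in_image[of \<pi> "{0..<n}" i] by auto
  then show "f dvd M $$ (i, \<pi> i) - N $$ (i, \<pi> i)"
    using dvd by simp
qed

text \<open>Over a field, a nonconstant divisor \<open>f\<close> of \<open>\<chi>\<^sub>A\<close> shares an eigenvalue with \<open>A\<close>, so that \<open>f(A)\<close> is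
  singular. To see this without a root of \<open>f\<close>, multiply \<open>f I = f(A) + (t I - A) Q\<close> by an inverse \<open>N\<close> of \<open>f(A)\<close>: then
  \<open>(t I - A) (- Q N)\<close> is the identity modulo \<open>f\<close>, and its determinant is a multiple of \<open>\<chi>\<^sub>A\<close>, hence
  of \<open>f\<close>.\<close>

lemma dvd_char_poly_value_not_right_invertible:
  fixes A :: "'a :: comm_ring_1 mat"
  assumes A: "A \<in> carrier_mat n n" and f: "f dvd char_poly A"
    and M: "poly_value n A f M" and N: "N \<in> carrier_mat n n" and MN: "M * N = 1\<^sub>m n"
  shows "f dvd 1"
proof -
  let ?T = "char_poly_matrix A"
  obtain Q where Q: "Q \<in> carrier_mat n n" and eq: "f \<cdot>\<^sub>m 1\<^sub>m n = const_mat M + ?T * Q"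
    using M unfolding poly_value_def by blast
  have M': "M \<in> carrier_mat n n"
    using M by (rule poly_value_carrier)
  have T: "?T \<in> carrier_mat n n"
    using A by simp
  have cM: "const_mat M \<in> carrier_mat n n" "const_mat N \<in> carrier_mat n n"
    using M' N by simp_all
  define Z where "Z = ?T * ((-1) \<cdot>\<^sub>m (Q * const_mat N))"
  have QN: "Q * const_mat N \<in> carrier_mat n n"
    using Q cM by simp
  have "f \<cdot>\<^sub>m const_mat N = (f \<cdot>\<^sub>m 1\<^sub>m n) * const_mat N"
    using cM by (simp add: mult_smult_assoc_mat[of _ n n _ n])
  also have "\<dots> = const_mat M * const_mat N + ?T * Q * const_mat N"
    unfolding eq using cM T Q by (intro add_mult_distrib_mat) auto
  also have "const_mat M * const_mat N = const_mat (1\<^sub>m n)"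
    using M' N by (simp add: const_mat_mult[symmetric] MN)
  also have "const_mat (1\<^sub>m n) = (1\<^sub>m n :: 'a poly mat)"
    by (rule eq_matI) (auto simp: const_mat_def one_pCons)
  also have "?T * Q * const_mat N = ?T * (Q * const_mat N)"
    using cM T Q by simp
  finally have fN: "f \<cdot>\<^sub>m const_mat N = 1\<^sub>m n + ?T * (Q * const_mat N)" .
  have Z: "Z \<in> carrier_mat n n"
    unfolding Z_def using T QN by simp
  have "f dvd det Z - det (1\<^sub>m n)"
  proof (rule det_diff_dvd[OF Z])
    fix i j assume ij: "i < n" "j < n"
    have "(f \<cdot>\<^sub>m const_mat N) $$ (i, j) = (1\<^sub>m n + ?T * (Q * const_mat N)) $$ (i, j)"
      by (simp only: fN)
    then have "f * const_mat N $$ (i, j) = 1\<^sub>m n $$ (i, j) + (?T * (Q * const_mat N)) $$ (i, j)"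
      using ij cM T QN by (simp del: index_mult_mat(1) index_one_mat(1))
    moreover have "Z $$ (i, j) = - (?T * (Q * const_mat N)) $$ (i, j)"
      unfolding Z_def mult_smult_distrib[OF T QN]
      using ij mult_carrier_mat[OF T QN] by (subst index_smult_mat(1)) auto
    ultimately have "Z $$ (i, j) - 1\<^sub>m n $$ (i, j) = f * (- const_mat N $$ (i, j))"
      by (simp add: algebra_simps)
    then show "f dvd Z $$ (i, j) - 1\<^sub>m n $$ (i, j)"
      by (rule dvdI)
  qed simp
  moreover have "det Z = char_poly A * det ((-1) \<cdot>\<^sub>m (Q * const_mat N))"
    unfolding Z_def char_poly_def using T QN by (intro det_mult) auto
  ultimately have "f dvd char_poly A * det ((-1) \<cdot>\<^sub>m (Q * const_mat N)) - 1"
    by simp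
  moreover have "f dvd char_poly A * det ((-1) \<cdot>\<^sub>m (Q * const_mat N))"
    using f by simp
  ultimately show ?thesis
    by (metis dvd_diff diff_diff_eq2 add_diff_cancel_left')
qed

lemma GL_inverse:
  assumes "A \<in> GL n"
  shows "\<exists>A' \<in> carrier_mat n n. A * A' = 1\<^sub>m n \<and> A' * A = 1\<^sub>m n"
proof -
  obtain A' where A: "A \<in> carrier_mat n n" and A': "A * A' = 1\<^sub>m n" "A' * A = 1\<^sub>m (dim_row A')"
    using assms unfolding GL_def invertible_mat_def inverts_mat_def by auto
  have "dim_col A' = n" "dim_row A' = n"
    using arg_cong[OF A'(1), of dim_col] arg_cong[OF A'(2), of dim_col] A by auto
  then show ?thesis
    using A' by (intro bexI[of _ A']) auto
qed

lemma coeff_0_char_poly_unit: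
  assumes "A \<in> GL n"
  shows "coeff (char_poly A) 0 dvd 1"
proof -
  obtain A' where A: "A \<in> carrier_mat n n" "A' \<in> carrier_mat n n" "A * A' = 1\<^sub>m n"
    using assms GL_inverse unfolding GL_def by blast
  have "coeff (char_poly A) 0 = poly (det (char_poly_matrix A)) 0"
    by (simp add: char_poly_def poly_0_coeff_0)
  also have "\<dots> = det (map_mat (\<lambda>p. poly p 0) (char_poly_matrix A))"
    by (rule comm_ring_hom.hom_det[symmetric]) (unfold_locales, simp_all)
  also have "map_mat (\<lambda>p. poly p 0) (char_poly_matrix A) = - A"
    using A by (intro eq_matI) (auto simp: char_poly_matrix_def)
  finally have "coeff (char_poly A) 0 * det (- A') = det (- A * - A')"
    using A by (subst det_mult[of _ n]) auto
  also have "- A * - A' = 1\<^sub>m n"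
    using A by simp
  finally show ?thesis
    by (metis det_one dvdI)
qed

lemma pow_mat_Suc_left:
  assumes "B \<in> carrier_mat n n"
  shows "B * B ^\<^sub>m k = B ^\<^sub>m Suc k"
proof (induction k)
  case (Suc k)
  have "B * B ^\<^sub>m Suc k = (B * B ^\<^sub>m k) * B"
    using assms by (simp add: assoc_mult_mat[of _ n n _ n _ n])
  then show ?case
    using Suc by simp
qed (use assms in simp)

lemma root_in_GL:
  assumes A: "B ^\<^sub>m k \<in> GL n" and B: "B \<in> carrier_mat n n" and k: "k > 0"
  shows "B \<in> GL n"
proof -
  obtain l where l: "k = Suc l"
    using k by (cases k) auto
  obtain A' where A': "A' \<in> carrier_mat n n" "B ^\<^sub>m k * A' = 1\<^sub>m n" "A' * B ^\<^sub>m k = 1\<^sub>m n"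
    using GL_inverse[OF A] by blast
  define R where "R = B ^\<^sub>m l * A'"
  define S where "S = A' * B ^\<^sub>m l"
  have C: "B ^\<^sub>m l \<in> carrier_mat n n"
    using B by simp
  have RS: "R \<in> carrier_mat n n" "S \<in> carrier_mat n n"
    unfolding R_def S_def using A' C by auto
  have "B * R = (B * B ^\<^sub>m l) * A'"
    unfolding R_def using A' B C by (simp add: assoc_mult_mat[of _ n n _ n _ n])
  then have BR: "B * R = 1\<^sub>m n"
    using A'(2) pow_mat_Suc_left[OF B] l by simp
  have "S * B = A' * (B ^\<^sub>m l * B)"
    unfolding S_def using A' B C by (simp add: assoc_mult_mat[of _ n n _ n _ n])
  then have SB: "S * B = 1\<^sub>m n"
    using A'(3) l by simp
  have "S = S * (B * R)"
    using RS by (simp add: BR)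
  also have "\<dots> = (S * B) * R"
    using RS B by simp
  finally have "S = R"
    using RS by (simp add: SB)
  then show ?thesis
    unfolding GL_def invertible_mat_def inverts_mat_def
    using B RS BR SB by auto
qed

section \<open>Reduction modulo the maximal ideal\<close>

interpretation residue_hom: comm_ring_hom to_residue
  by unfold_locales
    (simp_all add: plus_residue.abs_eq times_residue.abs_eq
      flip: zero_residue.abs_eq one_residue.abs_eq)

interpretation reduce_hom: map_poly_comm_ring_hom to_residue ..

lemma to_residue_eq_0_iff: "to_residue x = 0 \<longleftrightarrow> x \<in> max_ideal"
  unfolding zero_residue.abs_eq residue.abs_eq_iff by simp

lemma surj_to_residue: "\<exists>x. to_residue x = y"
  by (induction y rule: residue.abs_induct) blast

lemma finite_UNIV_residue: "finite (UNIV :: 'a :: finite_local_pir2 residue set)"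
proof -
  have "(UNIV :: 'a residue set) = range to_residue"
    using surj_to_residue by (metis UNIV_eq_I rangeI)
  then show ?thesis
    by (metis finite finite_imageI)
qed

lemma degree_reduce_monic:
  fixes F :: "'a :: finite_local_pir2 poly"
  assumes "monic F"
  shows "degree (reduce_poly F) = degree F"
  using assms by (intro map_poly_degree_eq) simp

lemma monic_reduce:
  fixes F :: "'a :: finite_local_pir2 poly"
  assumes "monic F"
  shows "monic (reduce_poly F)"
  using assms by (simp add: degree_reduce_monic coeff_map_poly)

text \<open>The side conditions say that the lift creates no leading terms.\<close>

lemma reduce_poly_lift:
  fixes f :: "'a :: finite_local_pir2 residue poly"
  shows "\<exists>F. reduce_poly F = f \<and> degree F = degree f \<and> (monic f \<longrightarrow> monic F) \<and> (f = 0 \<longrightarrow> F = 0)"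
proof -
  have "\<exists>x. to_residue x = y \<and> (y = 0 \<longrightarrow> x = 0) \<and> (y = 1 \<longrightarrow> x = 1)" for y :: "'a residue"
  proof -
    consider "y = 0" | "y = 1" | "y \<noteq> 0" "y \<noteq> 1"
      by blast
    then show ?thesis
    proof cases
      case 1
      then show ?thesis
        by (intro exI[of _ 0]) simp
    next
      case 2
      then show ?thesis
        by (intro exI[of _ 1]) simp
    next
      case 3
      then show ?thesis
        using surj_to_residue[of y] by auto
    qed
  qed
  then obtain \<sigma> where \<sigma>: "\<And>y :: 'a residue. to_residue (\<sigma> y) = y" "\<sigma> 0 = 0" "\<sigma> 1 = 1"
    by metis
  have nz: "\<sigma> y \<noteq> 0" if "y \<noteq> 0" for y
    using \<sigma>(1)[of y] that by auto
  have deg: "degree (map_poly \<sigma> f) = degree f"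
    by (rule Polynomial.degree_map_poly) (rule nz)
  have "reduce_poly (map_poly \<sigma> f) = f"
    by (rule poly_eqI) (simp add: coeff_map_poly \<sigma>)
  then show ?thesis
    using deg by (intro exI[of _ "map_poly \<sigma> f"]) (simp add: coeff_map_poly \<sigma>)
qed

lemma max_ideal_generator:
  obtains \<pi> :: "'a :: finite_local_pir2" where "max_ideal = range (\<lambda>a. \<pi> * a)" "\<pi> * \<pi> = 0"
proof -
  obtain \<pi> :: 'a where \<pi>: "max_ideal = range (\<lambda>a. \<pi> * a)"
    using principal_ideals[OF ring_ideal_max_ideal] by blast
  have "\<pi> = \<pi> * 1"
    by simp
  then have "\<pi> \<in> max_ideal"
    unfolding \<pi> by blast
  then show ?thesis
    using that \<pi> maximal_ideal_square_zero[OF max_ideal] by blast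
qed

text \<open>The cofactor may be chosen without new coefficients, so that degree bounds for \<open>e\<close> pass to it.\<close>

lemma reduce_poly_eq_0_multiple:
  fixes e :: "'a :: finite_local_pir2 poly"
  assumes \<pi>: "max_ideal = range (\<lambda>a :: 'a. \<pi> * a)" and e: "reduce_poly e = 0"
  shows "\<exists>c. e = Polynomial.smult \<pi> c \<and> (\<forall>i. coeff e i = 0 \<longrightarrow> coeff c i = 0)"
proof -
  have "\<exists>b. (a \<in> max_ideal \<longrightarrow> a = \<pi> * b) \<and> (a = 0 \<longrightarrow> b = 0)" for a :: 'a
    using \<pi> by (cases "a = 0") auto
  then obtain \<tau> where \<tau>: "\<And>a. a \<in> max_ideal \<Longrightarrow> a = \<pi> * \<tau> a" "\<tau> 0 = 0"
    by metis
  have "coeff e i \<in> max_ideal" for i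
    using arg_cong[OF e, of "\<lambda>f. coeff f i"] by (simp add: coeff_map_poly to_residue_eq_0_iff)
  then have "e = Polynomial.smult \<pi> (map_poly \<tau> e)"
    by (intro poly_eqI) (simp add: coeff_map_poly \<tau>)
  then show ?thesis
    using \<tau>(2) by (intro exI[of _ "map_poly \<tau> e"]) (simp add: coeff_map_poly)
qed

lemma reduce_poly_eq_0_mult:
  fixes e e' :: "'a :: finite_local_pir2 poly"
  assumes "reduce_poly e = 0" "reduce_poly e' = 0"
  shows "e * e' = 0"
proof -
  obtain \<pi> :: 'a where \<pi>: "max_ideal = range (\<lambda>a. \<pi> * a)" "\<pi> * \<pi> = 0"
    by (rule max_ideal_generator)
  obtain c c' where "e = Polynomial.smult \<pi> c" "e' = Polynomial.smult \<pi> c'"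
    using reduce_poly_eq_0_multiple[OF \<pi>(1)] assms by metis
  then show ?thesis
    by (simp add: \<pi>(2))
qed

text \<open>Such an \<open>f\<close> is \<open>1 + e\<close> with \<open>e\<^sup>2 = 0\<close>, and its inverse is \<open>1 - e = 2 - f\<close>.\<close>

lemma reduce_poly_eq_1_unit:
  fixes f :: "'a :: finite_local_pir2 poly"
  assumes "reduce_poly f = 1"
  shows "f dvd 1"
proof
  have "(f - 1) * (f - 1) = 0"
    by (rule reduce_poly_eq_0_mult) (simp_all add: assms reduce_hom.hom_minus)
  then show "1 = f * (2 - f)"
    by (simp add: algebra_simps)
qed

lemma comaximal_if_reduce_comaximal:
  fixes F G :: "'a :: finite_local_pir2 poly"
  assumes "comaximal (reduce_poly F) (reduce_poly G)"
  shows "comaximal F G"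
proof -
  obtain u v where uv: "u * reduce_poly F + v * reduce_poly G = 1"
    using assms unfolding comaximal_def by blast
  obtain U V where "reduce_poly U = u" "reduce_poly V = v"
    using reduce_poly_lift by metis
  then have "reduce_poly (U * F + V * G) = 1"
    using uv by (simp add: reduce_hom.hom_add reduce_hom.hom_mult)
  then show ?thesis
    by (intro comaximal_if_unit reduce_poly_eq_1_unit)
qed

lemma monic_add_smult:
  assumes "monic G" "R = 0 \<or> degree R < degree G"
  shows "monic (G + Polynomial.smult c R)"
proof (cases "R = 0")
  case False
  then have "degree (Polynomial.smult c R) < degree G"
    using assms(2) degree_smult_le[of c R] by simp
  then show ?thesis
    using assms(1) by (simp only: degree_add_eq_left coeff_add coeff_eq_0) simp
qed (use assms in simp)

section \<open>Hensel lifting of factorizations\<close>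

text \<open>Lift \<open>g\<close> and \<open>h\<close> arbitrarily to monic \<open>G\<^sub>0\<close> and \<open>H\<^sub>0\<close>. The error \<open>P - G\<^sub>0 H\<^sub>0\<close> is \<open>\<pi> c\<close>, where \<open>\<pi>\<close>
  generates \<open>\<mm>\<close>. As \<open>\<pi>\<^sup>2 = 0\<close>, the corrected factors \<open>G\<^sub>0 + \<pi> R\<close> and \<open>H\<^sub>0 + \<pi> S\<close> have the product \<open>P\<close> as soon
  as \<open>R H\<^sub>0 + S G\<^sub>0\<close> agrees with \<open>c\<close> modulo \<open>\<mm>\<close>. This is a linear equation over the residue field;
  the Bezout identity for \<open>g\<close> and \<open>h\<close> solves it, and a division by \<open>g\<close> makes the degrees small enough
  to keep both factors monic.\<close>

lemma hensel_lifting: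
  fixes P :: "'a :: finite_local_pir2 poly"
  assumes P: "monic P" and gh: "reduce_poly P = g * h" "monic g" "monic h" "comaximal g h"
  shows "\<exists>G H. monic G \<and> monic H \<and> P = G * H \<and> reduce_poly G = g \<and> reduce_poly H = h"
proof -
  obtain \<pi> :: 'a where \<pi>: "max_ideal = range (\<lambda>a. \<pi> * a)" "\<pi> * \<pi> = 0"
    by (rule max_ideal_generator)
  have red\<pi>: "reduce_poly (Polynomial.smult \<pi> c) = 0" for c
  proof -
    have "\<pi> * coeff c i \<in> max_ideal" for i
      unfolding \<pi> by blast
    then show ?thesis
      by (intro poly_eqI) (simp add: coeff_map_poly to_residue_eq_0_iff)
  qed
  obtain G\<^sub>0 H\<^sub>0 where G\<^sub>0: "reduce_poly G\<^sub>0 = g" "degree G\<^sub>0 = degree g" "monic G\<^sub>0"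
    and H\<^sub>0: "reduce_poly H\<^sub>0 = h" "degree H\<^sub>0 = degree h" "monic H\<^sub>0"
    using reduce_poly_lift gh(2,3) by metis
  obtain u v where uv: "u * g + v * h = 1"
    using gh(4) unfolding comaximal_def by blast
  have g0: "g \<noteq> 0" and h0: "h \<noteq> 0"
    using gh by auto
  define d where "d = degree g + degree h"
  have degP: "degree P = d"
    using degree_reduce_monic[OF P] by (simp add: gh d_def degree_mult_eq g0 h0)
  define e where "e = P - G\<^sub>0 * H\<^sub>0"
  have "reduce_poly e = 0"
    by (simp add: e_def reduce_hom.hom_minus reduce_hom.hom_mult gh G\<^sub>0 H\<^sub>0)
  then obtain c where c: "e = Polynomial.smult \<pi> c" "\<And>i. coeff e i = 0 \<Longrightarrow> coeff c i = 0"
    using reduce_poly_eq_0_multiple[OF \<pi>(1)] by blast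
  have "coeff (G\<^sub>0 * H\<^sub>0) d = 1" "degree (G\<^sub>0 * H\<^sub>0) \<le> d"
    using coeff_mult_degree_sum[of G\<^sub>0 H\<^sub>0] degree_mult_le[of G\<^sub>0 H\<^sub>0] G\<^sub>0 H\<^sub>0
    by (simp_all add: d_def)
  then have "coeff e i = 0" if "i \<ge> d" for i
    using that P degP by (cases "i = d") (auto simp: e_def coeff_eq_0)
  then have coeff_c: "coeff (reduce_poly c) i = 0" if "i \<ge> d" for i
    using that by (simp add: coeff_map_poly c(2))
  define w where "w = (reduce_poly c * v) div g"
  define r where "r = (reduce_poly c * v) mod g"
  define s where "s = reduce_poly c * u + w * h"
  have wr: "reduce_poly c * v = w * g + r"
    by (simp add: w_def r_def)
  have "r * h + s * g = (w * g + r) * h + reduce_poly c * u * g"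
    by (simp add: s_def algebra_simps)
  also have "\<dots> = reduce_poly c * (u * g + v * h)"
    unfolding wr[symmetric] by (simp add: algebra_simps)
  finally have rs: "r * h + s * g = reduce_poly c"
    by (simp add: uv)
  have deg_r: "r = 0 \<or> degree r < degree g"
    unfolding r_def by (rule degree_mod_less[OF g0])
  have deg_s: "s = 0 \<or> degree s < degree h"
  proof (rule ccontr)
    assume "\<not> ?thesis"
    then have s: "s \<noteq> 0" "degree h \<le> degree s"
      by auto
    define i where "i = degree (s * g)"
    have i: "i = degree s + degree g"
      using s g0 by (simp add: i_def degree_mult_eq)
    have "coeff (r * h) i = 0"
    proof (cases "r = 0")
      case False
      then have "degree (r * h) < i"
        using deg_r s(2) h0 by (simp add: i degree_mult_eq)
      then show ?thesis
        by (rule coeff_eq_0)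
    qed simp
    moreover have "coeff (r * h + s * g) i = 0"
      unfolding rs using s(2) by (intro coeff_c) (simp add: i d_def)
    moreover have "coeff (s * g) i \<noteq> 0"
      using s(1) g0 by (simp add: i_def)
    ultimately show False
      by simp
  qed
  obtain R S where R: "reduce_poly R = r" "degree R = degree r" "r = 0 \<longrightarrow> R = 0"
    and S: "reduce_poly S = s" "degree S = degree s" "s = 0 \<longrightarrow> S = 0"
    using reduce_poly_lift by metis
  define G where "G = G\<^sub>0 + Polynomial.smult \<pi> R"
  define H where "H = H\<^sub>0 + Polynomial.smult \<pi> S"
  have "monic G" "monic H"
    unfolding G_def H_def using deg_r deg_s R S G\<^sub>0 H\<^sub>0 by (intro monic_add_smult; auto)+
  moreover have "reduce_poly G = g" "reduce_poly H = h"
    by (simp_all add: G_def H_def reduce_hom.hom_add red\<pi> G\<^sub>0 H\<^sub>0)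
  moreover have "P = G * H"
  proof -
    have "reduce_poly (R * H\<^sub>0 + S * G\<^sub>0 - c) = 0"
      using rs by (simp add: reduce_hom.hom_minus reduce_hom.hom_add reduce_hom.hom_mult R S G\<^sub>0 H\<^sub>0)
    then have "[:\<pi>:] * (R * H\<^sub>0 + S * G\<^sub>0 - c) = 0"
      using red\<pi>[of 1] by (intro reduce_poly_eq_0_mult) simp_all
    then have "Polynomial.smult \<pi> (R * H\<^sub>0 + S * G\<^sub>0) = e"
      by (simp add: c(1) smult_diff_right)
    moreover have "G * H = G\<^sub>0 * H\<^sub>0 + Polynomial.smult \<pi> (R * H\<^sub>0 + S * G\<^sub>0)"
      by (simp add: G_def H_def algebra_simps smult_add_right \<pi>(2))
    ultimately show ?thesis
      by (simp add: e_def)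
  qed
  ultimately show ?thesis
    by blast
qed

lemma monic_fundamental_irreducible_not_unit:
  fixes F :: "'a :: finite_local_pir2 poly"
  assumes "monic_fundamental_irreducible F"
  shows "\<not> F dvd 1"
proof
  assume "F dvd 1"
  then have "reduce_poly F dvd 1"
    using reduce_hom.hom_dvd[of F 1] by simp
  then show False
    using assms by (simp add: monic_fundamental_irreducible_def irreducible_def)
qed

text \<open>Hensel lifting splits off one irreducible factor of the reduction at a time.\<close>

lemma fundamental_factorization_exists:
  fixes P :: "'a :: finite_local_pir2 poly"
  assumes "monic P" "separable_poly (reduce_poly P)"
  shows "\<exists>S. fundamental_factorization P S"
  using assms
proof (induction "degree P" arbitrary: P rule: less_induct)
  case less
  show ?case
  proof (cases "degree P = 0")
    case True
    then have "P = 1"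
      using less.prems(1) by (rule monic_degree_0[THEN iffD1, rotated])
    then show ?thesis
      by (intro exI[of _ "{}"]) (simp add: fundamental_factorization_def)
  next
    case False
    have "\<not> reduce_poly P dvd 1"
      using False degree_reduce_monic[OF less.prems(1)] by (auto dest: poly_dvd_1[THEN iffD1])
    then obtain f where f: "monic f" "irreducible f" "f dvd reduce_poly P"
      using monic_irreducible_dvd by blast
    then obtain h where h: "reduce_poly P = f * h"
      by blast
    have "monic h"
      using monic_reduce[OF less.prems(1)] f(1) by (simp add: h lead_coeff_mult)
    moreover have comax: "comaximal f h"
      using less.prems(2) unfolding h by (rule separable_mult_comaximal)
    ultimately obtain F H where FH: "monic F" "monic H" "P = F * H" "reduce_poly F = f" "reduce_poly H = h"
      using hensel_lifting[OF less.prems(1) h f(1)] by blast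
    have F: "monic_fundamental_irreducible F"
      using FH f by (simp add: monic_fundamental_irreducible_def)
    have "degree F > 0"
      using f(2) degree_reduce_monic[OF FH(1)] FH(4) by (auto simp: irreducible_def is_unit_iff_degree)
    then have "degree H < degree P"
      using FH(2,3) degree_monic_mult[OF FH(1), of H] by (cases "H = 0") auto
    moreover have "separable_poly (reduce_poly H)"
      using less.prems(2) by (rule separable_poly_dvd) (simp only: h FH(5) dvd_triv_right)
    ultimately obtain S where S: "fundamental_factorization H S"
      using less.hyps FH(2) by blast
    have FS: "comaximal F F'" if "F' \<in> S" for F'
    proof (rule comaximal_dvd_dvd[OF _ dvd_refl])
      show "comaximal F H"
        using comax FH by (intro comaximal_if_reduce_comaximal) simp
      show "F' dvd H"
        using S that dvd_prodI[of S F' "\<lambda>F. F"] by (auto simp: fundamental_factorization_def)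
    qed
    have "F \<notin> S"
    proof
      assume "F \<in> S"
      from comaximal_dvd_unit[OF FS[OF this] dvd_refl dvd_refl] show False
        using monic_fundamental_irreducible_not_unit[OF F] by simp
    qed
    then have "fundamental_factorization P (insert F S)"
      using S F FS FH(3) unfolding fundamental_factorization_def
      by (auto simp: pairwise_insert comaximal_commute)
    then show ?thesis ..
  qed
qed

lemma fundamental_factorization_reduce_comaximal:
  assumes "fundamental_factorization P S" "F \<in> S" "F' \<in> S" "F \<noteq> F'"
  shows "comaximal (reduce_poly F) (reduce_poly F')"
proof (rule comaximal_hom[OF reduce_hom.comm_ring_hom_axioms])
  show "comaximal F F'"
    using assms unfolding fundamental_factorization_def pairwise_def by blast
qed

section \<open>Roots of the variable modulo a polynomial\<close>

lemma dvd_diff_mult: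
  fixes a b c d m :: "'a :: comm_ring_1"
  assumes "m dvd a - b" "m dvd c - d"
  shows "m dvd a * c - b * d"
proof -
  have "a * c - b * d = a * (c - d) + (a - b) * d"
    by (simp add: algebra_simps)
  then show ?thesis
    using assms by simp
qed

lemma dvd_diff_power:
  fixes a b m :: "'a :: comm_ring_1"
  assumes "m dvd a - b"
  shows "m dvd a ^ k - b ^ k"
  by (induction k) (simp_all add: dvd_diff_mult assms)

lemma power_Suc_add_square_zero:
  fixes x e :: "'a :: comm_ring_1"
  assumes "e * e = 0"
  shows "(x + e) ^ Suc k = x ^ Suc k + of_nat (Suc k) * x ^ k * e"
proof (induction k)
  case (Suc k)
  have "(x + e) ^ Suc (Suc k) = (x + e) * (x ^ Suc k + of_nat (Suc k) * x ^ k * e)"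
    by (simp only: power_Suc[of _ "Suc k"] Suc)
  also have "\<dots> = x ^ Suc (Suc k) + of_nat (Suc (Suc k)) * x ^ Suc k * e
      + of_nat (Suc k) * x ^ k * (e * e)"
    by (simp add: algebra_simps)
  finally show ?case
    by (simp add: assms)
qed simp

text \<open>In \<open>R[t]\<close> write \<open>Q\<^sub>0\<^sup>L \<equiv> t + N\<close> modulo \<open>P\<close>, for a lift \<open>Q\<^sub>0\<close> of \<open>q\<close> and an \<open>N\<close> with coefficients in \<open>\<mm>\<close>.
  Taking \<open>p\<close>-th powers removes \<open>N\<close>, because \<open>N\<^sup>2 = 0\<close> and \<open>p N = 0\<close>: the power \<open>t\<^sup>p\<close> has the \<open>L\<close>-th root
  \<open>Q\<^sub>0\<^sup>p\<close> modulo \<open>P\<close>. Since \<open>P(0)\<close> is a unit, \<open>t\<close> has an inverse \<open>Y\<close> modulo \<open>P\<close>; with \<open>p v = L u + 1\<close> an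
  \<open>L\<close>-th root of \<open>t = t\<^sup>p\<^sup>v t\<^sup>-\<^sup>L\<^sup>u\<close> is \<open>Q\<^sub>0\<^sup>p\<^sup>v Y\<^sup>u\<close>.\<close>

lemma root_lift:
  fixes P :: "'a :: finite_local_pir2 poly"
  assumes p: "CHAR('a residue) = p" "p > 0" and L: "coprime L p"
    and unit: "coeff P 0 dvd 1"
    and root: "reduce_poly P dvd q ^ L - monom 1 1"
  shows "\<exists>Q. P dvd Q ^ L - monom 1 1"
proof -
  define X :: "'a poly" where "X = monom 1 1"
  obtain Q\<^sub>0 where Q\<^sub>0: "reduce_poly Q\<^sub>0 = q"
    using reduce_poly_lift by metis
  obtain h where h: "q ^ L - monom 1 1 = reduce_poly P * h"
    using root by blast
  obtain H where H: "reduce_poly H = h"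
    using reduce_poly_lift by metis
  define N where "N = Q\<^sub>0 ^ L - X - P * H"
  have N: "reduce_poly N = 0"
    using h by (simp add: N_def X_def reduce_hom.hom_minus reduce_hom.hom_mult reduce_hom.hom_power
        Q\<^sub>0 H map_poly_monom)
  obtain k where k: "p = Suc k"
    using p(2) by (cases p) auto
  have "to_residue (of_nat p :: 'a) = 0"
    using p(1) by (metis of_nat_CHAR residue_hom.hom_of_nat)
  then have "reduce_poly (of_nat p :: 'a poly) = 0"
    by (intro poly_eqI) (simp add: of_nat_poly coeff_map_poly coeff_pCons split: nat.split)
  then have "(of_nat p :: 'a poly) * N = 0"
    using N by (rule reduce_poly_eq_0_mult)
  then have XN: "(X + N) ^ p = X ^ p"
    using power_Suc_add_square_zero[OF reduce_poly_eq_0_mult[OF N N], of X k]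
    unfolding k by (simp add: mult.assoc mult.left_commute[of _ "X ^ k"] del: power_Suc of_nat_Suc)
  have "P dvd Q\<^sub>0 ^ L - (X + N)"
    by (simp add: N_def)
  from dvd_diff_power[OF this, of p] have Qp: "P dvd (Q\<^sub>0 ^ L) ^ p - X ^ p"
    by (simp only: XN)
  obtain a P' where P: "P = pCons a P'"
    by (cases P)
  have P': "P = [:a:] + X * P'"
    unfolding P X_def by (rule pCons_eq_monom)
  obtain b where b: "1 = a * b"
    using unit unfolding P coeff_pCons_0 by (rule dvdE)
  define Y where "Y = - ([:b:] * P')"
  have "X * Y - 1 = P * (- [:b:])"
  proof -
    have "P * [:b:] = [:a:] * [:b:] + X * P' * [:b:]"
      unfolding P' by (rule distrib_right)
    also have "[:a:] * [:b:] = 1"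
      using b by (simp add: one_pCons mult.commute)
    finally show ?thesis
      by (simp add: Y_def algebra_simps)
  qed
  then have XY: "P dvd X * Y - 1"
    by (rule dvdI)
  obtain v u where vu: "p * v = L * u + 1"
    using bezout_nat[of p L] p(2) L by (auto simp: coprime_iff_gcd_eq_1 gcd.commute)
  define Q where "Q = Q\<^sub>0 ^ (p * v) * Y ^ u"
  have "Q ^ L = ((Q\<^sub>0 ^ L) ^ p) ^ v * Y ^ (L * u)"
    by (simp add: Q_def power_mult_distrib ac_simps flip: power_mult)
  moreover have "P dvd ((Q\<^sub>0 ^ L) ^ p) ^ v * Y ^ (L * u) - (X ^ p) ^ v * Y ^ (L * u)"
    by (rule dvd_diff_mult[OF dvd_diff_power[OF Qp]]) simp
  moreover have "(X ^ p) ^ v * Y ^ (L * u) = (X * Y) ^ (L * u) * X"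
    by (simp add: vu power_mult_distrib ac_simps flip: power_mult)
  moreover have "P dvd (X * Y) ^ (L * u) * X - 1 ^ (L * u) * X"
    by (rule dvd_diff_mult[OF dvd_diff_power[OF XY]]) simp
  ultimately have "P dvd (Q ^ L - (X * Y) ^ (L * u) * X) + ((X * Y) ^ (L * u) * X - X)"
    by (intro dvd_add) simp_all
  then show ?thesis
    by (intro exI[of _ Q]) (simp add: X_def)
qed

section \<open>Matrix roots\<close>

text \<open>For each \<open>f\<close> in \<open>S\<close> the matrix \<open>f(B\<^sup>L)\<close> is singular, so \<open>f(t\<^sup>L)\<close> and \<open>\<chi>\<^sub>B\<close> have a common irreducible
  factor \<open>\<gamma> f\<close>, for otherwise a Bezout identity evaluated at \<open>B\<close> would invert it. The degree of \<open>\<gamma> f\<close> is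
  at least that of \<open>f\<close>. The \<open>\<gamma> f\<close> are pairwise comaximal and their product divides \<open>\<chi>\<^sub>B\<close>, so that their
  degrees add up to at most \<open>n\<close>, the sum of the degrees of the \<open>f\<close>. Hence all these inequalities
  are equalities.\<close>

lemma matrix_root_irreducible_factors:
  fixes B :: "'a :: field mat"
  assumes fin: "finite (UNIV :: 'a set)" and B: "B \<in> carrier_mat n n"
    and S: "finite S" "\<And>f. f \<in> S \<Longrightarrow> irreducible f"
    and comax: "\<And>f f'. f \<in> S \<Longrightarrow> f' \<in> S \<Longrightarrow> f \<noteq> f' \<Longrightarrow> comaximal f f'"
    and prod: "\<Prod>S = char_poly (B ^\<^sub>m L)" and f: "f \<in> S"
  shows "\<exists>g. monic g \<and> irreducible g \<and> g dvd pcompose f (monom 1 L) \<and> degree g = degree f"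
proof -
  note C = pow_carrier_mat[OF B, of L]
  have S_dvd: "f dvd char_poly (B ^\<^sub>m L)" if "f \<in> S" for f
    using that S(1) dvd_prodI[of S f "\<lambda>f. f"] by (simp add: prod)
  have "\<exists>g. monic g \<and> irreducible g \<and> g dvd pcompose f (monom 1 L) \<and> g dvd char_poly B"
    if "f \<in> S" for f
  proof -
    have "\<not> comaximal (pcompose f (monom 1 L)) (char_poly B)"
    proof
      assume "comaximal (pcompose f (monom 1 L)) (char_poly B)"
      then obtain u v where uv: "u * pcompose f (monom 1 L) + v * char_poly B = 1"
        unfolding comaximal_def by blast
      obtain M where M: "poly_value n (B ^\<^sub>m L) f M" "poly_value n B (pcompose f (monom 1 L)) M"
        using poly_value_pcompose_monom[OF B] by blast
      obtain N V where N: "poly_value n B u N" and V: "poly_value n B v V"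
        using poly_value_exists[OF B] by metis
      have carrier: "M \<in> carrier_mat n n" "N \<in> carrier_mat n n" "V \<in> carrier_mat n n"
        using M N V by (auto dest: poly_value_carrier)
      have "poly_value n B 1 (N * M + V * 0\<^sub>m n n)"
        using poly_value_add[OF B poly_value_mult[OF B N M(2)]
            poly_value_mult[OF B V poly_value_char_poly[OF B]]]
        by (simp add: uv)
      moreover have "poly_value n B 1 (1\<^sub>m n)"
        using poly_value_power[OF B N, of 0] carrier by simp
      ultimately have "N * M + V * 0\<^sub>m n n = 1\<^sub>m n"
        by (rule poly_value_unique[OF B])
      then have "N * M = 1\<^sub>m n"
        using carrier by simp
      then have "M * N = 1\<^sub>m n"
        using carrier mat_mult_left_right_inverse by blast
      from dvd_char_poly_value_not_right_invertible[OF C S_dvd[OF that] M(1) carrier(2) this]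
      show False
        using S(2)[OF that] by (simp add: irreducible_def)
    qed
    then show ?thesis
      by (rule not_comaximal_common_irreducible)
  qed
  then obtain \<gamma> where \<gamma>: "\<And>f. f \<in> S \<Longrightarrow> monic (\<gamma> f)" "\<And>f. f \<in> S \<Longrightarrow> irreducible (\<gamma> f)"
    "\<And>f. f \<in> S \<Longrightarrow> \<gamma> f dvd pcompose f (monom 1 L)" "\<And>f. f \<in> S \<Longrightarrow> \<gamma> f dvd char_poly B"
    by metis
  have deg_le: "degree f \<le> degree (\<gamma> f)" if "f \<in> S" for f
    using degree_le_of_dvd_power_subst[OF fin] S(2) \<gamma> that by blast
  have "prod \<gamma> S dvd char_poly B"
  proof (rule pairwise_comaximal_prod_dvd[OF S(1)])
    fix f f' assume ff': "f \<in> S" "f' \<in> S" "f \<noteq> f'"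
    show "comaximal (\<gamma> f) (\<gamma> f')"
      by (rule comaximal_dvd_dvd[OF comaximal_pcompose[OF comax[OF ff']] \<gamma>(3)[OF ff'(1)] \<gamma>(3)[OF ff'(2)]])
  qed (rule \<gamma>(4))
  moreover have "char_poly B \<noteq> 0" "degree (char_poly B) = n"
    using degree_monic_char_poly[OF B] by auto
  ultimately have "degree (prod \<gamma> S) \<le> n"
    using dvd_imp_degree_le by metis
  then have "(\<Sum>f\<in>S. degree (\<gamma> f)) \<le> n"
    using \<gamma>(2) by (subst degree_prod_sum_eq[symmetric]) auto
  moreover have "(\<Sum>f\<in>S. degree f) = n"
    using S(2) degree_monic_char_poly[OF C] degree_prod_sum_eq[of S "\<lambda>f. f"]
    by (fastforce simp: prod)
  moreover have "(\<Sum>f\<in>S. degree f) \<le> (\<Sum>f\<in>S. degree (\<gamma> f))"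
    by (rule sum_mono) (rule deg_le)
  ultimately have "(\<Sum>f\<in>S. degree f) = (\<Sum>f\<in>S. degree (\<gamma> f))"
    by simp
  then have "degree f = degree (\<gamma> f)"
    using deg_le f S(1) by (rule sum_mono_inv)
  then show ?thesis
    using \<gamma> f by metis
qed


lemma reduce_pcompose_monom:
  "reduce_poly (pcompose F (monom 1 L)) = pcompose (reduce_poly F) (monom 1 L)"
  by (simp add: residue_hom.map_poly_pcompose map_poly_monom)

theorem theorem1:
  fixes A :: "'a :: finite_local_pir2 mat" and n L p :: nat
  assumes "CHAR('a residue) = p" and "prime p" and "odd p"
    and "L > 0" and "coprime L p"
    and "A \<in> GL n" and "regular_semisimple A"
  shows "(\<exists>B \<in> GL n. B ^\<^sub>m L = A) \<longleftrightarrow>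
    (\<forall>F. fundamental_irreducible_factor F (char_poly A) \<longrightarrow> L_power_polynomial L F)"
proof -
  define P where "P = char_poly A"
  have A: "A \<in> carrier_mat n n"
    using assms(6) by (simp add: GL_def)
  have P: "monic P"
    using degree_monic_char_poly[OF A] by (simp add: P_def)
  have redP: "char_poly (reduce_mat A) = reduce_poly P"
    unfolding P_def by (rule residue_hom.char_poly_hom[OF A])
  have sep: "separable_poly (reduce_poly P)"
    using assms(7) by (simp add: regular_semisimple_def redP)
  have unit: "coeff P 0 dvd 1"
    unfolding P_def by (rule coeff_0_char_poly_unit[OF assms(6)])
  have "\<not> p dvd L"
    using assms(2,5) by (metis coprime_absorb_right not_prime_unit)
  then have L: "of_nat L \<noteq> (0 :: 'a residue)"
    using assms(1) by (simp add: of_nat_eq_0_iff_char_dvd)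
  show ?thesis
    unfolding P_def[symmetric]
  proof (intro iffI allI impI)
    fix F
    assume "\<exists>B \<in> GL n. B ^\<^sub>m L = A" and "fundamental_irreducible_factor F P"
    then obtain B S where B: "B \<in> carrier_mat n n" "B ^\<^sub>m L = A"
      and S: "fundamental_factorization P S" and F: "F \<in> S"
      unfolding GL_def fundamental_irreducible_factor_def by blast
    have mfi: "monic_fundamental_irreducible F" if "F \<in> S" for F
      using S that by (simp add: fundamental_factorization_def)
    then have irr: "irreducible (reduce_poly F)" if "F \<in> S" for F
      using that by (simp add: monic_fundamental_irreducible_def)
    have fin: "finite S" and prodS: "\<Prod>S = P"
      using S by (simp_all add: fundamental_factorization_def)
    note comax = fundamental_factorization_reduce_comaximal[OF S]
    have inj: "inj_on reduce_poly S"
    proof (rule inj_onI, rule ccontr)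
      fix F F' assume *: "F \<in> S" "F' \<in> S" "reduce_poly F = reduce_poly F'" "F \<noteq> F'"
      from comaximal_dvd_unit[OF comax[OF *(1,2,4)] dvd_refl] irr[OF *(1)] *(3) show False
        by (simp add: irreducible_def)
    qed
    have "\<Prod>(reduce_poly ` S) = reduce_poly (\<Prod>S)"
      by (simp add: prod.reindex[OF inj] reduce_hom.hom_prod)
    also have "\<dots> = char_poly (reduce_mat B ^\<^sub>m L)"
      by (simp add: prodS redP[symmetric] B(2)[symmetric] residue_hom.mat_hom_pow[OF B(1)])
    finally have prod: "\<Prod>(reduce_poly ` S) = char_poly (reduce_mat B ^\<^sub>m L)" .
    have "\<exists>g. monic g \<and> irreducible g \<and> g dvd pcompose (reduce_poly F) (monom 1 L) \<and>
        degree g = degree (reduce_poly F)"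
    proof (rule matrix_root_irreducible_factors[OF finite_UNIV_residue _ _ _ _ prod])
      show "reduce_mat B \<in> carrier_mat n n"
        using B by simp
    qed (use fin irr comax F in auto)
    then obtain g where g: "monic g" "irreducible g"
      "g dvd pcompose (reduce_poly F) (monom 1 L)" "degree g = degree (reduce_poly F)"
      by blast
    have FP: "F dvd P"
      using F fin dvd_prodI[of S F "\<lambda>F. F"] by (simp add: prodS)
    have monicF: "monic F"
      using mfi[OF F] by (simp add: monic_fundamental_irreducible_def)
    have "separable_poly (reduce_poly F)"
      using sep reduce_hom.hom_dvd[OF FP] by (rule separable_poly_dvd)
    moreover have "coeff (reduce_poly F) 0 \<noteq> 0"
    proof -
      obtain H where "P = F * H"
        using FP by blast
      then have "coeff F 0 dvd 1"
        using unit by (simp add: coeff_mult_0)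
      then have "to_residue (coeff F 0) dvd 1"
        using residue_hom.hom_dvd[of "coeff F 0" 1] by simp
      then show ?thesis
        by (auto simp: coeff_map_poly)
    qed
    ultimately have sepL: "separable_poly (reduce_poly (pcompose F (monom 1 L)))"
      unfolding reduce_pcompose_monom using L by (rule separable_pcompose_monom)
    obtain h where h: "reduce_poly (pcompose F (monom 1 L)) = g * h"
      using g(3) unfolding reduce_pcompose_monom by blast
    have monicL: "monic (pcompose F (monom 1 L))"
      using monicF assms(4) by (rule monic_pcompose_monom)
    have "monic h"
      using monic_reduce[OF monicL] g(1) by (simp add: h lead_coeff_mult)
    moreover have "comaximal g h"
      using sepL unfolding h by (rule separable_mult_comaximal)
    ultimately obtain G H where G: "monic G" "pcompose F (monom 1 L) = G * H" "reduce_poly G = g"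
      using hensel_lifting[OF monicL h g(1)] by blast
    then have "monic_fundamental_irreducible G" "G dvd pcompose F (monom 1 L)"
      using g(2) by (simp_all add: monic_fundamental_irreducible_def)
    moreover have "degree G = degree F"
      using g(4) G degree_reduce_monic[OF G(1)] degree_reduce_monic[OF monicF] by simp
    ultimately show "L_power_polynomial L F"
      using mfi[OF F] by (auto simp: L_power_polynomial_def)
  next
    assume hyp: "\<forall>F. fundamental_irreducible_factor F P \<longrightarrow> L_power_polynomial L F"
    obtain S where S: "fundamental_factorization P S"
      using fundamental_factorization_exists[OF P sep] by blast
    have fin: "finite S" and prodS: "\<Prod>S = P"
      using S by (simp_all add: fundamental_factorization_def)
    note comax = fundamental_factorization_reduce_comaximal[OF S]
    have "\<exists>q. reduce_poly F dvd q ^ L - monom 1 1" if "F \<in> S" for F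
    proof -
      have "L_power_polynomial L F"
        using hyp S that unfolding fundamental_irreducible_factor_def by blast
      then obtain G where F: "monic F" "irreducible (reduce_poly F)"
        and G: "monic G" "irreducible (reduce_poly G)" "G dvd pcompose F (monom 1 L)" "degree G = degree F"
        unfolding L_power_polynomial_def monic_fundamental_irreducible_def by blast
      have "reduce_poly G dvd pcompose (reduce_poly F) (monom 1 L)"
        using reduce_hom.hom_dvd[OF G(3)] by (simp only: reduce_pcompose_monom)
      moreover have "degree (reduce_poly G) = degree (reduce_poly F)"
        using F G by (simp add: degree_reduce_monic)
      ultimately show ?thesis
        using F(2) G(2) by (intro variable_is_power_mod[OF finite_UNIV_residue])
    qed
    then obtain r where r: "\<And>F. F \<in> S \<Longrightarrow> reduce_poly F dvd r F ^ L - monom 1 1"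
      by metis
    obtain q where q: "\<And>F. F \<in> S \<Longrightarrow> reduce_poly F dvd q - r F"
      using chinese_remainder_comaximal[OF fin, of reduce_poly r] comax by blast
    have "(\<Prod>F\<in>S. reduce_poly F) dvd q ^ L - monom 1 1"
    proof (rule pairwise_comaximal_prod_dvd[OF fin comax])
      fix F assume "F \<in> S"
      from dvd_add[OF dvd_diff_power[OF q[OF this], of L] r[OF this]]
      show "reduce_poly F dvd q ^ L - monom 1 1"
        by simp
    qed
    then have "reduce_poly P dvd q ^ L - monom 1 1"
      unfolding prodS[symmetric] reduce_hom.hom_prod .
    then obtain Q where "P dvd Q ^ L - monom 1 1"
      using root_lift[OF assms(1) prime_gt_0_nat[OF assms(2)] assms(5) unit] by blast
    then obtain H where H: "Q ^ L = monom 1 1 + P * H"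
      by (metis add.commute diff_add_cancel dvdE)
    obtain B N where B: "poly_value n A Q B" and N: "poly_value n A H N"
      using poly_value_exists[OF A] by metis
    have carrier: "B \<in> carrier_mat n n" "N \<in> carrier_mat n n"
      using B N by (auto dest: poly_value_carrier)
    have "poly_value n A (monom 1 1 + P * H) (A + 0\<^sub>m n n * N)"
      unfolding P_def
      by (intro poly_value_add[OF A] poly_value_mult[OF A] poly_value_variable[OF A]
          poly_value_char_poly[OF A] N)
    then have "B ^\<^sub>m L = A + 0\<^sub>m n n * N"
      using poly_value_power[OF A B, of L] unfolding H by (intro poly_value_unique[OF A])
    then have "B ^\<^sub>m L = A"
      using A carrier by simp
    moreover from this have "B \<in> GL n"
      using assms(4,6) carrier by (intro root_in_GL[of B L]) simp_all
    ultimately show "\<exists>B \<in> GL n. B ^\<^sub>m L = A"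
      by blast
  qed
qed

end
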